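(* Let $p^\dagger=\max\{2,p\}$. Then there is $\epsilon\in\mathcal E^*$ with $\mathrm{res}^{p^\dagger}(\epsilon)=0$ such that $\delta^*[\epsilon]$ is the minimum value of $\delta^*$ on $(0,1)$. In particular, if $p\le2$, then the minimum value of $\delta^*$ is $\delta^*[\beta^1]=1$.
   Context: Coefficient functions. A coefficient function is a sequence $\mu=(\mu_1,\mu_2,\dots)$ of non-negative integers; it has finite support if only finitely many $\mu_k$ are nonzero. $0$ is the zero coefficient function; for $i\ge1$, $\beta^i$ has $\beta^i_i=1$ and $\beta^i_k=0$ for $k\ne i$. Sums are entrywise. For a real sequence $G$, $\sum\mu G:=\sum_{k\ge1}\mu_kG_k$. For $n\ge1$: $\mathrm{rev}_n(\mu)=(\mu_n,\mu_{n-1},\dots,\mu_1,0,0,\dots)$; $\mathrm{res}_n(\mu)$ agrees with $\mu$ at indices $\le n$ and is $0$ at indices $>n$; $\mathrm{res}^n(\mu)$ agrees with $\mu$ at indices $\ge n$ and is $0$ at indices $<n$. For finite-support $\mu\ne\mu'$, $\mu<_a\mu'$ means $\mu_k<\mu'_k$ for the largest $k$ with $\mu_k\ne\mu'_k$; for arbitrary $\epsilon\ne\epsilon'$, $\epsilon<_d\epsilon'$ means $\epsilon_k<\epsilon'_k$ for the smallest $k$ with $\epsilon_k\ne\epsilon'_k$. Collections for positive integers. For a list $L=(e_1,\dots,e_N)$ of non-negative integers with $N\ge2$, $e_1\ne0$, let $\beta^*$ be the coefficient function with $\beta^*_k=e_j$ whenever $k\equiv j\pmod N$, $1\le j\le N$;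 for $n\ge2$ let $\theta^n=\mathrm{rev}_{n-1}(\beta^* )$ (the maximal $L$-block at index $n-1$, support interval $[1,n-1]$). A proper $L$-block at index $n-1$ ($n\ge2$) is a coefficient function $\zeta$ such that for some $k\in[1,n-1]$: $\zeta_j=\theta^n_j$ for $j>k$, $\zeta_k<\theta^n_k$, $\zeta_j=0$ for $j<k$; its support interval is $[k,n-1]$. The periodic Zeckendorf collection for positive integers determined by $L$ is the set of all finite sums (including $0$) of $L$-blocks with pairwise disjoint support intervals. Its fundamental sequence $H$ is $H_1=1$, $H_n=1+\sum\theta^nH$ ($n\ge2$). The polynomial $x^N-\sum_{k=1}^{N-1}e_kx^{N-k}-(1+e_N)$ has a unique positive zero, which is $>1$. Collections for $(0,1)$. For such $L$ and $n\ge1$, the maximal $L^*$-block at index $n$ is $\bar\beta^n$ with $\bar\beta^n_k=0$ for $k<n$ and $\bar\beta^n_k=e_j$ for $k\ge n$, where $1\le j\le N$, $k-n+1\equiv j\pmod N$. A proper $L^*$-block at index $n$ is a coefficient function $\zeta$ such that for some $k\ge n$: $\zeta_j=\bar\beta^n_j$ for $j<k$, $\zeta_k<\bar\beta^n_k$, $\zeta_j=0$ for $j>k$; its support interval is $[n,k]$. The periodic Zeckendorf collection for $(0,1)$ determined by $L$ is the set of nonzero coefficient functions that are finite or infinite sums of proper $L^*$-blocks with pairwise disjoint support intervals. Standing setup. $L=(e_1,\dots,e_N)$ and $\widetilde L=(\tilde e_1,\dots,\tilde e_M)$ are two such lists whose collections for positive integers $\mathcal E,\widetilde{\mathcal E}$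 satisfy $\mathcal E\subsetneq\widetilde{\mathcal E}$; $\phi,\widetilde\phi$ are the positive zeros of their polynomials (one has $1<\phi<\widetilde\phi$); $\gamma=\log_{\widetilde\phi}\phi$; $\omega=1/\phi$, $\widetilde\omega=1/\widetilde\phi$, $Q_n=\omega^n$, $\widetilde Q_n=\widetilde\omega^n$. $\mathcal E^*,\widetilde{\mathcal E}^*$ are the collections for $(0,1)$ determined by $L,\widetilde L$, and $\bar\beta^n$ the maximal $L^*$-blocks. The map $\epsilon\mapsto\sum\epsilon\widetilde Q$ is a bijection $\widetilde{\mathcal E}^*\to(0,1)$, strictly increasing for $<_d$. For nonzero finite-support $\mu$: $\check\mu$ is the $<_a$-largest element of $\mathcal E$ that is $<_a\mu$, and $\bar\mu$ is the $<_a$-smallest element of $\mathcal E$ that is $>_a\check\mu$. For $\epsilon\in\widetilde{\mathcal E}^*$: if $\epsilon=\bar\beta^1$ or $\bar\beta^1<_d\epsilon$, set $\overline{\mathrm{rev}}(\epsilon)=\bar\beta^1$; otherwise $\overline{\mathrm{rev}}(\epsilon)=\lim_{n\to\infty}\mathrm{rev}_n\big(\overline{\mathrm{rev}_n(\epsilon)}\big)$ (entrywise limit, which exists). Define $\delta_1^*:[\widetilde\omega,1)\to\mathbb R$ by $\delta_1^*(\sum\epsilon\widetilde Q)=\sum\overline{\mathrm{rev}}(\epsilon)Q\,/\,(\sum\epsilon\widetilde Q)^\gamma$ for $\epsilon\in\widetilde{\mathcal E}^*$, and $\delta^*:(0,1)\to\mathbb R$ by $\delta^*(y)=\delta_1^*(y/\widetilde\omega^{n-1})$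 where $n\ge1$ satisfies $\widetilde\omega^n\le y<\widetilde\omega^{n-1}$. Write $\delta^*[\epsilon]=\delta^*(\sum\epsilon\widetilde Q)$. $p$ is the smallest positive integer with $\gamma\widetilde\omega^{p-1}<\omega^p$. *)

theory Defs
  imports Complex_Main "HOL-Computational_Algebra.Polynomial"
begin

text \<open>
  A coefficient function \<open>\<mu> = (\<mu>\<^sub>1, \<mu>\<^sub>2, \<dots>)\<close> is a function on \<^typ>\<open>nat\<close> whose (meaningless) value at
  index 0 is 0; every operation and collection below respects this convention.
\<close>

type_synonym coeff_fun = "nat \<Rightarrow> nat"

definition unit_cf :: "nat \<Rightarrow> coeff_fun" where
  "unit_cf i = (\<lambda>k. if k = i then 1 else 0)"

definition wsum :: "coeff_fun \<Rightarrow> (nat \<Rightarrow> real) \<Rightarrow> real" where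
  "wsum \<mu> G = (\<Sum>k. real (\<mu> (Suc k)) * G (Suc k))"

definition rev_cf :: "nat \<Rightarrow> coeff_fun \<Rightarrow> coeff_fun" where
  "rev_cf n \<mu> = (\<lambda>k. if 1 \<le> k \<and> k \<le> n then \<mu> (n + 1 - k) else 0)"

definition res_ge :: "nat \<Rightarrow> coeff_fun \<Rightarrow> coeff_fun" where
  "res_ge n \<mu> = (\<lambda>k. if n \<le> k then \<mu> k else 0)"

definition less_a :: "coeff_fun \<Rightarrow> coeff_fun \<Rightarrow> bool" where
  "less_a \<mu> \<mu>' \<longleftrightarrow> (\<exists>k. \<mu> k < \<mu>' k \<and> (\<forall>j>k. \<mu> j = \<mu>' j))"

definition less_d :: "coeff_fun \<Rightarrow> coeff_fun \<Rightarrow> bool" where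
  "less_d \<epsilon> \<epsilon>' \<longleftrightarrow> (\<exists>k. \<epsilon> k < \<epsilon>' k \<and> (\<forall>j<k. \<epsilon> j = \<epsilon>' j))"

text \<open>The entry \<open>e\<^sub>j\<close> of \<open>L = (e\<^sub>1, \<dots>, e\<^sub>N)\<close> is \<open>L ! (j - 1)\<close>.\<close>

definition zeck_list :: "nat list \<Rightarrow> bool" where
  "zeck_list L \<longleftrightarrow> length L \<ge> 2 \<and> L ! 0 \<noteq> 0"

definition beta_star :: "nat list \<Rightarrow> coeff_fun" where
  "beta_star L = (\<lambda>k. if k = 0 then 0 else L ! ((k - 1) mod length L))"

definition theta :: "nat list \<Rightarrow> nat \<Rightarrow> coeff_fun" where
  "theta L n = rev_cf (n - 1) (beta_star L)"

text \<open>
  Blocks are paired with their support intervals: the same coefficient function (for instance 0)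
  can be a block with several different support intervals.
\<close>

definition max_blocks :: "nat list \<Rightarrow> (coeff_fun \<times> nat set) set" where
  "max_blocks L = {(theta L n, {1..n - 1}) | n. n \<ge> 2}"

definition proper_blocks :: "nat list \<Rightarrow> (coeff_fun \<times> nat set) set" where
  "proper_blocks L = {(\<zeta>, {k..n - 1}) | \<zeta> k n. n \<ge> 2 \<and> k \<in> {1..n - 1} \<and>
     (\<forall>j>k. \<zeta> j = theta L n j) \<and> \<zeta> k < theta L n k \<and> (\<forall>j<k. \<zeta> j = 0)}"

definition disjoint_supports :: "(coeff_fun \<times> nat set) set \<Rightarrow> bool" where
  "disjoint_supports B \<longleftrightarrow> pairwise (\<lambda>b b'. snd b \<inter> snd b' = {}) B"

definition int_collection :: "nat list \<Rightarrow> coeff_fun set" where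
  "int_collection L = {(\<lambda>j. \<Sum>b\<in>B. fst b j) | B.
     finite B \<and> B \<subseteq> max_blocks L \<union> proper_blocks L \<and> disjoint_supports B}"

definition zeck_poly :: "nat list \<Rightarrow> real poly" where
  "zeck_poly L = (let N = length L in
     monom 1 N - (\<Sum>k = 1..N - 1. monom (real (L ! (k - 1))) (N - k))
       - [:1 + real (L ! (N - 1)):])"

definition phi :: "nat list \<Rightarrow> real" where
  "phi L = (THE x. 0 < x \<and> poly (zeck_poly L) x = 0)"

definition omega :: "nat list \<Rightarrow> real" where
  "omega L = 1 / phi L"

definition Qseq :: "nat list \<Rightarrow> nat \<Rightarrow> real" where
  "Qseq L n = omega L ^ n"

definition beta_bar :: "nat list \<Rightarrow> nat \<Rightarrow> coeff_fun" where
  "beta_bar L n = (\<lambda>k. if k < n then 0 else L ! ((k - n) mod length L))"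

definition proper_star_blocks :: "nat list \<Rightarrow> (coeff_fun \<times> nat set) set" where
  "proper_star_blocks L = {(\<zeta>, {n..k}) | \<zeta> n k. 1 \<le> n \<and> n \<le> k \<and>
     (\<forall>j<k. \<zeta> j = beta_bar L n j) \<and> \<zeta> k < beta_bar L n k \<and> (\<forall>j>k. \<zeta> j = 0)}"

text \<open>
  A family of blocks may be infinite here, but by disjointness of the support intervals at most one
  of them is nonzero at a given index, so the entrywise sum is a sum over a finite set.
\<close>

definition star_collection :: "nat list \<Rightarrow> coeff_fun set" where
  "star_collection L = {(\<lambda>j. \<Sum>b | b \<in> B \<and> fst b j \<noteq> 0. fst b j) | B.
     B \<subseteq> proper_star_blocks L \<and> disjoint_supports B} - {\<lambda>_. 0}"

definition check_cf :: "nat list \<Rightarrow> coeff_fun \<Rightarrow> coeff_fun" where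
  "check_cf L \<mu> = (THE \<nu>. \<nu> \<in> int_collection L \<and> less_a \<nu> \<mu> \<and>
     (\<forall>\<xi>\<in>int_collection L. less_a \<xi> \<mu> \<longrightarrow> \<xi> = \<nu> \<or> less_a \<xi> \<nu>))"

definition bar_cf :: "nat list \<Rightarrow> coeff_fun \<Rightarrow> coeff_fun" where
  "bar_cf L \<mu> = (THE \<nu>. \<nu> \<in> int_collection L \<and> less_a (check_cf L \<mu>) \<nu> \<and>
     (\<forall>\<xi>\<in>int_collection L. less_a (check_cf L \<mu>) \<xi> \<longrightarrow> \<xi> = \<nu> \<or> less_a \<nu> \<xi>))"

text \<open>The limit is taken in the discrete space \<^typ>\<open>nat\<close>.\<close>

definition rev_bar :: "nat list \<Rightarrow> coeff_fun \<Rightarrow> coeff_fun" where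
  "rev_bar L \<epsilon> = (if \<epsilon> = beta_bar L 1 \<or> less_d (beta_bar L 1) \<epsilon> then beta_bar L 1
     else (\<lambda>k. lim (\<lambda>n. rev_cf n (bar_cf L (rev_cf n \<epsilon>)) k)))"

text \<open>In what follows \<open>L\<close> is the list of the smaller collection and \<open>L'\<close> that of the larger one.\<close>

definition gam :: "nat list \<Rightarrow> nat list \<Rightarrow> real" where
  "gam L L' = log (phi L') (phi L)"

text \<open>Only the values of \<open>delta_one\<close> on \<open>[omega L', 1)\<close> and of \<open>delta_star\<close> on \<open>(0, 1)\<close> are meaningful.\<close>

definition delta_one :: "nat list \<Rightarrow> nat list \<Rightarrow> real \<Rightarrow> real" where
  "delta_one L L' y =
     (let \<epsilon> = (THE \<epsilon>. \<epsilon> \<in> star_collection L' \<and> wsum \<epsilon> (Qseq L') = y)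
      in wsum (rev_bar L \<epsilon>) (Qseq L) / y powr gam L L')"

definition delta_star :: "nat list \<Rightarrow> nat list \<Rightarrow> real \<Rightarrow> real" where
  "delta_star L L' y =
     (let n = (THE n. 1 \<le> n \<and> omega L' ^ n \<le> y \<and> y < omega L' ^ (n - 1))
      in delta_one L L' (y / omega L' ^ (n - 1)))"

definition delta_star_at :: "nat list \<Rightarrow> nat list \<Rightarrow> coeff_fun \<Rightarrow> real" where
  "delta_star_at L L' \<epsilon> = delta_star L L' (wsum \<epsilon> (Qseq L'))"

definition pmin :: "nat list \<Rightarrow> nat list \<Rightarrow> nat" where
  "pmin L L' = (LEAST p. 1 \<le> p \<and> gam L L' * omega L' ^ (p - 1) < omega L ^ p)"

end

theory Submission
  imports Defs
begin

text \<open>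
  Reading an expansion digit by digit from the leading end, membership in a Zeckendorf collection is
  decided by a deterministic automaton whose state is the number of digits of the maximal block
  matched so far. Hence a collection is described by its digit stream \<open>b\<close>, and the expansions are the
  sequences whose digits never exceed the digit of \<open>b\<close> at the current state; lexicographic order
  corresponds to the order of values.

  On \<open>[omega L', 1)\<close> the numerator of \<open>\<delta>\<^sup>*\<close> at an expansion that is not \<open>L\<close>-admissible is its value at
  the next larger \<open>L\<close>-admissible one, while the denominator is smaller than there; so only
  \<open>L\<close>-admissible expansions compete for the minimum. For those, dropping all digits of index
  \<open>\<ge> max 2 p\<close> does not increase the quotient: by Bernoulli's inequality \<open>(1 + u)\<^sup>\<gamma> \<le> 1 + \<gamma> u\<close> this
  reduces to \<open>\<gamma> / omega L' < (omega L / omega L')\<^sup>p\<close>, the defining property of \<open>p\<close>. Finitely many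
  candidates remain.
\<close>

section \<open>Parsing into blocks\<close>

text \<open>No monotonicity is imposed on the lists, so the rest of a maximal block may be worth
  more than 1 (for the list (1, 5) the base is 1/3 and the stream after its first digit has value
  2), and admissibility cannot be tested by comparing shifts with the stream lexicographically.
  Hence the arguments run through the state: a mismatched digit gives up at least one unit, and what
  follows starts afresh in state 0, where it is worth at most 1. The constant p comes from three
  bounds for truncation after m digits. Let X0, Y0 be the kept values and A, B the values of the
  dropped tails in the bases \<open>omega L\<close>, \<open>omega L'\<close>. Then X0 \<le> 1, Y0
  \<ge> \<open>omega L'\<close> and \<open>omega L * B \<le> omega L' * A\<close>, and Bernoulli's
  inequality leaves \<open>gam L L' * omega L' ^ m \<le> omega L ^ Suc m\<close>, the condition on p
  with m = p - 1. The maximum with 2 ensures m \<ge> 1, so that the leading digit survives and the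
  truncated value stays in \<open>[omega L', 1)\<close>.\<close>

primrec pstate :: "(nat \<Rightarrow> nat) \<Rightarrow> (nat \<Rightarrow> nat) \<Rightarrow> nat \<Rightarrow> nat" where
  "pstate b x 0 = 0"
| "pstate b x (Suc i) = (if x i = b (pstate b x i) then Suc (pstate b x i) else 0)"

definition admissible :: "(nat \<Rightarrow> nat) \<Rightarrow> (nat \<Rightarrow> nat) \<Rightarrow> bool" where
  "admissible b x \<longleftrightarrow> (\<forall>i. x i \<le> b (pstate b x i))"

text \<open>Rules out tails that follow \<open>b\<close> forever, the counterpart of decimals ending
  in 999...; it lets every block of the parse end and makes values injective.\<close>

definition recurrent :: "(nat \<Rightarrow> nat) \<Rightarrow> (nat \<Rightarrow> nat) \<Rightarrow> bool" where
  "recurrent b x \<longleftrightarrow> (\<forall>i. \<exists>j\<ge>i. x j \<noteq> b (pstate b x j))"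

lemma pstate_cong: "(\<And>j. j < i \<Longrightarrow> x j = y j) \<Longrightarrow> pstate b x i = pstate b y i"
  by (induction i) auto

lemma pstate_le: "pstate b x i \<le> i"
  by (induction i) auto

text \<open>A state grows by one or drops to 0, so state s records s consecutive matches that began
  in state 0.\<close>

lemma pstate_run: "j \<le> pstate b x i \<Longrightarrow> pstate b x (i - pstate b x i + j) = j"
proof (induction i arbitrary: j)
  case (Suc i)
  show ?case
  proof (cases "x i = b (pstate b x i)")
    case True
    with Suc pstate_le[of b x i] show ?thesis
      by (cases "j = Suc (pstate b x i)") auto
  next
    case False
    with Suc show ?thesis by simp
  qed
qed simp

lemma pstate_run_match:
  assumes "j < pstate b x i"
  shows "x (i - pstate b x i + j) = b j"
proof -
  have "pstate b x (Suc (i - pstate b x i + j)) = Suc j"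
    using pstate_run[of "Suc j" b x i] assms by simp
  then show ?thesis using pstate_run[of j b x i] assms by (auto split: if_splits)
qed

lemma pstate_step: "(\<And>j. n \<le> j \<Longrightarrow> j < n + d \<Longrightarrow> x j = b (pstate b x j)) \<Longrightarrow>
    pstate b x (n + d) = pstate b x n + d"
  by (induction d) auto

text \<open>A leading 0 falls short of \<open>b 0\<close> and leads back to state 0. This allows
  padding with leading zeros.\<close>

lemma pstate_shift: "0 < b 0 \<Longrightarrow> pstate b (case_nat 0 x) (Suc i) = pstate b x i"
  by (induction i) auto

lemma admissible_shift:
  assumes "0 < b 0"
  shows "admissible b (case_nat 0 x) \<longleftrightarrow> admissible b x"
proof -
  have "admissible b (case_nat 0 x) \<longleftrightarrow>
      (\<forall>i. case_nat 0 x (Suc i) \<le> b (pstate b (case_nat 0 x) (Suc i)))"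
    unfolding admissible_def by (metis le0 nat.case(1) not0_implies_Suc)
  then show ?thesis
    unfolding admissible_def by (simp only: pstate_shift[of b, OF assms] nat.case(2))
qed

text \<open>Positions count from 0 at the leading digit, and a pair \<open>(n, k)\<close> stands for a block on
  \<open>{n..k}\<close>. A block may end with all its digits matched only at a position in \<open>F\<close>; this models
  the maximal blocks of the collection for positive integers.\<close>

definition parsed :: "(nat \<Rightarrow> nat) \<Rightarrow> nat set \<Rightarrow> (nat \<Rightarrow> nat) \<Rightarrow> (nat \<times> nat) set \<Rightarrow> bool" where
  "parsed b F x P \<longleftrightarrow>
     (\<forall>(n, k)\<in>P. n \<le> k \<and> (\<forall>j. n \<le> j \<and> j < k \<longrightarrow> x j = b (j - n)) \<and>
        (x k < b (k - n) \<or> k \<in> F \<and> x k = b (k - n))) \<and>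
     (\<forall>(n, k)\<in>P. \<forall>(n', k')\<in>P. \<forall>j. j \<in> {n..k} \<and> j \<in> {n'..k'} \<longrightarrow> n = n' \<and> k = k') \<and>
     (\<forall>j. (\<forall>(n, k)\<in>P. j \<notin> {n..k}) \<longrightarrow> x j = 0)"

lemma parsed_zero: "parsed b F x P \<Longrightarrow> \<forall>(n, k)\<in>P. j \<notin> {n..k} \<Longrightarrow> x j = 0"
  unfolding parsed_def by blast

text \<open>A proper block ends below the stream and thereby resets the state, and a position
  outside all blocks carries 0 < \<open>b 0\<close>; so the state is the offset within the current
  block. A block closed by a full match does not reset the state, whence the restriction to
  positions up to \<open>m\<close>.\<close>

lemma parsed_pstate:
  assumes P: "parsed b F x P" and b0: "0 < b 0" and F: "\<And>f. f \<in> F \<Longrightarrow> m \<le> f" and "i \<le> m"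
  shows "(\<forall>(n, k)\<in>P. i \<in> {n..k} \<longrightarrow> pstate b x i = i - n) \<and>
    ((\<forall>(n, k)\<in>P. i \<notin> {n..k}) \<longrightarrow> pstate b x i = 0)"
  using \<open>i \<le> m\<close>
proof (induction i)
  case (Suc i)
  then have IH1: "\<And>n k. (n, k) \<in> P \<Longrightarrow> i \<in> {n..k} \<Longrightarrow> pstate b x i = i - n"
    and IH2: "(\<forall>(n, k)\<in>P. i \<notin> {n..k}) \<Longrightarrow> pstate b x i = 0" and "i \<notin> F"
    using F[of i] by auto
  have D: "\<And>n k n' k' j. (n, k) \<in> P \<Longrightarrow> (n', k') \<in> P \<Longrightarrow> j \<in> {n..k} \<Longrightarrow> j \<in> {n'..k'} \<Longrightarrow>
      n = n' \<and> k = k'"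
    and M: "\<And>n k j. (n, k) \<in> P \<Longrightarrow> n \<le> j \<Longrightarrow> j < k \<Longrightarrow> x j = b (j - n)"
    and E: "\<And>n k. (n, k) \<in> P \<Longrightarrow> x k < b (k - n) \<or> k \<in> F \<and> x k = b (k - n)"
    and Z: "\<And>j. (\<forall>(n, k)\<in>P. j \<notin> {n..k}) \<Longrightarrow> x j = 0"
    using P unfolding parsed_def by blast+
  show ?case
  proof (cases "\<exists>(n, k)\<in>P. i \<in> {n..k}")
    case True
    then obtain n k where nk: "(n, k) \<in> P" "i \<in> {n..k}" by auto
    note s = IH1[OF nk]
    show ?thesis
    proof (cases "i = k")
      case True
      then have "pstate b x (Suc i) = 0"
        using E[OF nk(1)] \<open>i \<notin> F\<close> s by auto
      moreover have "n' = Suc i" if "(n', k') \<in> P" "Suc i \<in> {n'..k'}" for n' k'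
        using D[OF nk(1) that(1), of i] nk that True by (cases "n' \<le> i") auto
      ultimately show ?thesis by fastforce
    next
      case False
      then have "pstate b x (Suc i) = Suc i - n" "Suc i \<in> {n..k}"
        using M[OF nk(1), of i] nk s by auto
      then show ?thesis using D[OF nk(1), of _ _ "Suc i"] nk(1) by fast
    qed
  next
    case False
    then have no: "\<forall>(n, k)\<in>P. i \<notin> {n..k}" by auto
    then have "pstate b x (Suc i) = 0" using IH2[OF no] Z[OF no] b0 by simp
    moreover have "n' = Suc i" if "(n', k') \<in> P" "Suc i \<in> {n'..k'}" for n' k'
      using no that by fastforce
    ultimately show ?thesis by fastforce
  qed
qed auto

lemma parsed_digit_le:
  assumes P: "parsed b F x P" and b0: "0 < b 0" and F: "\<And>f. f \<in> F \<Longrightarrow> m \<le> f" and "i \<le> m"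
  shows "x i \<le> b (pstate b x i)"
proof (cases "\<exists>(n, k)\<in>P. i \<in> {n..k}")
  case True
  then obtain n k where nk: "(n, k) \<in> P" "i \<in> {n..k}" by auto
  have "pstate b x i = i - n"
    using parsed_pstate[OF assms] nk by auto
  moreover have "x i \<le> b (i - n)"
    using P nk unfolding parsed_def by (cases "i = k") fastforce+
  ultimately show ?thesis by simp
next
  case False
  then show ?thesis using P unfolding parsed_def by (auto simp: case_prod_beta)
qed

lemma parsed_admissible_recurrent:
  assumes P: "parsed b {} x P" and b0: "0 < b 0"
  shows "admissible b x" "recurrent b x"
proof -
  show "admissible b x"
    unfolding admissible_def using parsed_digit_le[OF P b0] by blast
  show "recurrent b x"
    unfolding recurrent_def
  proof
    fix i
    show "\<exists>j\<ge>i. x j \<noteq> b (pstate b x j)"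
    proof (cases "\<exists>(n, k)\<in>P. i \<in> {n..k}")
      case True
      then obtain n k where nk: "(n, k) \<in> P" "i \<in> {n..k}" by auto
      have "pstate b x k = k - n"
        using parsed_pstate[OF P b0, of k k] nk by auto
      moreover have "x k < b (k - n)" using P nk unfolding parsed_def by auto
      ultimately show ?thesis using nk by (intro exI[of _ k]) auto
    next
      case False
      then have "x i = 0" "pstate b x i = 0"
        using parsed_pstate[OF P b0, of i i] P unfolding parsed_def by (auto simp: case_prod_beta)
      then show ?thesis using b0 by (intro exI[of _ i]) auto
    qed
  qed
qed

text \<open>The converse direction: cut after every mismatch. The hypothesis \<open>ends\<close>
  says that each block terminates; it is recurrence when \<open>F\<close> is empty and automatic
  when \<open>F\<close> consists of the last position alone.\<close>

lemma admissible_parsed: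
  assumes adm: "admissible b x"
    and ends: "\<And>j. (\<forall>f\<in>F. j \<le> f) \<Longrightarrow> \<exists>k\<ge>j. (x k \<noteq> b (pstate b x k) \<or> k \<in> F) \<and> (\<forall>f\<in>F. k \<le> f)"
    and zero: "\<And>j f. f \<in> F \<Longrightarrow> f < j \<Longrightarrow> x j = 0"
  shows "\<exists>P. parsed b F x P \<and> (\<forall>(n, k)\<in>P. \<forall>f\<in>F. k \<le> f)"
proof -
  \<comment> \<open>The ends of blocks: mismatches and positions in \<open>F\<close>. Positions
    beyond an element of \<open>F\<close> are left out.\<close>
  define Q where "Q k \<longleftrightarrow> (x k \<noteq> b (pstate b x k) \<or> k \<in> F) \<and> (\<forall>f\<in>F. k \<le> f)" for k
  \<comment> \<open>Blocks run from a position in state 0 to the next end; a mismatch in state 0 is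
    a block of length one.\<close>
  define P where "P = {(n, k). n \<le> k \<and> pstate b x n = 0 \<and>
    (\<forall>j. n \<le> j \<and> j < k \<longrightarrow> x j = b (pstate b x j) \<and> j \<notin> F) \<and> Q k}"
  have st: "pstate b x j = j - n" if "(n, k) \<in> P" "j \<in> {n..k}" for n k j
    using pstate_step[of n "j - n" x b] that unfolding P_def by auto
  \<comment> \<open>Inside a block the state is positive after its first position, so no other block
    starts there.\<close>
  have same_start: "n = n'" if "(n, k) \<in> P" "(n', k') \<in> P" "j \<in> {n..k}" "j \<in> {n'..k'}" for n k n' k' j
  proof (cases n n' rule: linorder_cases)
    case less
    then show ?thesis using st[OF that(1), of n'] that by (auto simp: P_def)
  next
    case greater
    then show ?thesis using st[OF that(2), of n] that by (auto simp: P_def)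
  qed
  have same_end: "k = k'" if "(n, k) \<in> P" "(n, k') \<in> P" for n k k'
    using that unfolding P_def Q_def by (cases k k' rule: linorder_cases) auto
  have cover: "\<exists>(n, k)\<in>P. j \<in> {n..k}" if j: "\<forall>f\<in>F. j \<le> f" for j
  proof -
    define k where "k = (LEAST k. j \<le> k \<and> Q k)"
    have ex: "\<exists>k. j \<le> k \<and> Q k" using ends[OF j] unfolding Q_def by blast
    have k: "j \<le> k" "Q k" using LeastI_ex[OF ex] unfolding k_def by auto
    have before: "\<not> Q i" if "j \<le> i" "i < k" for i
      using not_less_Least[of i "\<lambda>k. j \<le> k \<and> Q k"] that unfolding k_def by auto
    \<comment> \<open>Back to the start of the run of matches that leads to
      \<open>j\<close>.\<close>
    define n where "n = j - pstate b x j"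
    have n: "n \<le> j" "pstate b x n = 0"
      using pstate_run[of 0 b x j] by (auto simp: n_def)
    have "x i = b (pstate b x i) \<and> i \<notin> F" if i: "n \<le> i" "i < k" for i
    proof (cases "i < j")
      case True
      define d where "d = i - n"
      have d: "i = n + d" "d < pstate b x j"
        using i True pstate_le[of b x j] by (auto simp: d_def n_def)
      have "x i = b (pstate b x i)"
        using pstate_run_match[OF d(2)] pstate_run[of d b x j] d by (simp add: n_def)
      then show ?thesis using True j by (auto simp: not_le)
    next
      case False
      then show ?thesis using before[of i] i k(2) unfolding Q_def by fastforce
    qed
    then have "(n, k) \<in> P" using n k unfolding P_def by auto
    then show ?thesis using n k by auto
  qed
  have "parsed b F x P"
    unfolding parsed_def
  proof (intro conjI)
    show "\<forall>(n, k)\<in>P. n \<le> k \<and> (\<forall>j. n \<le> j \<and> j < k \<longrightarrow> x j = b (j - n)) \<and>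
        (x k < b (k - n) \<or> k \<in> F \<and> x k = b (k - n))"
    proof clarify
      fix n k assume nk: "(n, k) \<in> P"
      then have le: "n \<le> k" by (auto simp: P_def)
      have "x j = b (j - n)" if "n \<le> j" "j < k" for j
        using st[OF nk, of j] nk that by (auto simp: P_def)
      moreover have "x k < b (k - n) \<or> k \<in> F \<and> x k = b (k - n)"
        using st[OF nk, of k] le nk adm[unfolded admissible_def, rule_format, of k]
        by (auto simp: P_def Q_def)
      ultimately show "n \<le> k \<and> (\<forall>j. n \<le> j \<and> j < k \<longrightarrow> x j = b (j - n)) \<and>
        (x k < b (k - n) \<or> k \<in> F \<and> x k = b (k - n))" using le by blast
    qed
    show "\<forall>(n, k)\<in>P. \<forall>(n', k')\<in>P. \<forall>j. j \<in> {n..k} \<and> j \<in> {n'..k'} \<longrightarrow> n = n' \<and> k = k'"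
      using same_start same_end by blast
    show "\<forall>j. (\<forall>(n, k)\<in>P. j \<notin> {n..k}) \<longrightarrow> x j = 0"
    proof (intro allI impI)
      fix j assume "\<forall>(n, k)\<in>P. j \<notin> {n..k}"
      then have "\<not> (\<forall>f\<in>F. j \<le> f)" using cover[of j] by fast
      then show "x j = 0" using zero[of _ j] by (auto simp: not_le)
    qed
  qed
  moreover have "\<forall>(n, k)\<in>P. \<forall>f\<in>F. k \<le> f" by (auto simp: P_def Q_def)
  ultimately show ?thesis by blast
qed

section \<open>Collections as admissible sequences\<close>

definition dig :: "nat list \<Rightarrow> nat \<Rightarrow> nat" where
  "dig L s = L ! (s mod length L)"

lemma dig_0_pos: "zeck_list L \<Longrightarrow> 0 < dig L 0"
  by (simp add: zeck_list_def dig_def)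

lemma beta_bar_dig: "beta_bar L n k = (if k < n then 0 else dig L (k - n))"
  by (simp add: beta_bar_def dig_def)

lemma theta_dig: "theta L n k = (if 1 \<le> k \<and> k \<le> n - 1 then dig L (n - 1 - k) else 0)"
  by (auto simp: theta_def rev_cf_def beta_star_def dig_def)

lemma proper_star_block_iff:
  "(\<zeta>, I) \<in> proper_star_blocks L \<longleftrightarrow> (\<exists>n k. I = {n..k} \<and> 1 \<le> n \<and> n \<le> k \<and>
     (\<forall>j. j \<notin> {n..k} \<longrightarrow> \<zeta> j = 0) \<and> (\<forall>j. n \<le> j \<and> j < k \<longrightarrow> \<zeta> j = dig L (j - n)) \<and>
     \<zeta> k < dig L (k - n))"
  (is "?l \<longleftrightarrow> (\<exists>n k. ?R n k)")
proof
  assume ?l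
  then obtain n k where "I = {n..k}" "1 \<le> n" "n \<le> k" "\<forall>j<k. \<zeta> j = beta_bar L n j"
    "\<zeta> k < beta_bar L n k" "\<forall>j>k. \<zeta> j = 0"
    unfolding proper_star_blocks_def by blast
  then have "?R n k" by (auto simp: beta_bar_dig not_le)
  then show "\<exists>n k. ?R n k" by blast
next
  assume "\<exists>n k. ?R n k"
  then obtain n k where R: "?R n k" by blast
  then have "\<zeta> j = beta_bar L n j" if "j < k" for j
    using that by (cases "n \<le> j") (auto simp: beta_bar_dig)
  then have "1 \<le> n \<and> n \<le> k \<and> (\<forall>j<k. \<zeta> j = beta_bar L n j) \<and> \<zeta> k < beta_bar L n k \<and> (\<forall>j>k. \<zeta> j = 0)"
    using R by (auto simp: beta_bar_dig)
  then show ?l using R unfolding proper_star_blocks_def by blast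
qed

text \<open>Read from the top index \<open>m\<close> downwards, both kinds of blocks follow the
  digit stream and differ only at the lowest index: a full match there means a maximal block, which
  reaches down to index 1.\<close>

lemma int_block_iff:
  "(\<zeta>, I) \<in> max_blocks L \<union> proper_blocks L \<longleftrightarrow> (\<exists>k m. I = {k..m} \<and> 1 \<le> k \<and> k \<le> m \<and>
     (\<forall>j. j \<notin> {k..m} \<longrightarrow> \<zeta> j = 0) \<and> (\<forall>j. k < j \<and> j \<le> m \<longrightarrow> \<zeta> j = dig L (m - j)) \<and>
     (\<zeta> k < dig L (m - k) \<or> k = 1 \<and> \<zeta> k = dig L (m - k)))"
  (is "?l \<longleftrightarrow> (\<exists>k m. ?R k m)")
proof
  assume ?l
  then consider n where "\<zeta> = theta L n" "I = {1..n - 1}" "n \<ge> 2"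
    | n k where "I = {k..n - 1}" "n \<ge> 2" "k \<in> {1..n - 1}" "\<forall>j>k. \<zeta> j = theta L n j"
      "\<zeta> k < theta L n k" "\<forall>j<k. \<zeta> j = 0"
    unfolding max_blocks_def proper_blocks_def by blast
  then show "\<exists>k m. ?R k m"
  proof cases
    case (1 n)
    then have "?R 1 (n - 1)" by (auto simp: theta_dig)
    then show ?thesis by blast
  next
    case (2 n k)
    then have "?R k (n - 1)" by (auto simp: theta_dig not_le)
    then show ?thesis by blast
  qed
next
  assume "\<exists>k m. ?R k m"
  then obtain k m where R: "?R k m" by blast
  show ?l
  proof (cases "\<zeta> k < dig L (m - k)")
    case True
    then have "Suc m \<ge> 2 \<and> k \<in> {1..Suc m - 1} \<and> (\<forall>j>k. \<zeta> j = theta L (Suc m) j) \<and>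
        \<zeta> k < theta L (Suc m) k \<and> (\<forall>j<k. \<zeta> j = 0)" "I = {k..Suc m - 1}"
      using R by (auto simp: theta_dig)
    then show ?thesis unfolding proper_blocks_def by blast
  next
    case False
    then have "\<zeta> j = theta L (Suc m) j" for j
      using R by (cases "j = 1") (auto simp: theta_dig)
    then have "\<zeta> = theta L (Suc m)" "I = {1..Suc m - 1}" "Suc m \<ge> 2" using R False by auto
    then show ?thesis unfolding max_blocks_def by blast
  qed
qed

section \<open>Sums of disjoint blocks and admissible sequences\<close>

lemma sum_disjoint_blocks:
  assumes disj: "disjoint_supports B"
    and supp: "\<And>c j. c \<in> B \<Longrightarrow> j \<notin> snd c \<Longrightarrow> fst c j = (0::nat)"
  shows "c \<in> B \<Longrightarrow> j \<in> snd c \<Longrightarrow> (\<Sum>c | c \<in> B \<and> fst c j \<noteq> 0. fst c j) = fst c j"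
    and "(\<And>c. c \<in> B \<Longrightarrow> j \<notin> snd c) \<Longrightarrow> (\<Sum>c | c \<in> B \<and> fst c j \<noteq> 0. fst c j) = 0"
proof -
  assume c: "c \<in> B" "j \<in> snd c"
  have uniq: "c' = c" if "c' \<in> B" "fst c' j \<noteq> 0" for c'
    using disj supp[OF that(1), of j] c that unfolding disjoint_supports_def pairwise_def by blast
  show "(\<Sum>c | c \<in> B \<and> fst c j \<noteq> 0. fst c j) = fst c j"
  proof (cases "fst c j = 0")
    case True
    then have "\<not> (c' \<in> B \<and> fst c' j \<noteq> 0)" for c' using uniq[of c'] by metis
    then show ?thesis using True by simp
  next
    case False
    then have "(c' \<in> B \<and> fst c' j \<noteq> 0) = (c' = c)" for c' using uniq[of c'] c(1) by metis
    then show ?thesis by simp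
  qed
next
  assume "\<And>c. c \<in> B \<Longrightarrow> j \<notin> snd c"
  then show "(\<Sum>c | c \<in> B \<and> fst c j \<noteq> 0. fst c j) = 0" using supp by (intro sum.neutral) auto
qed

lemma star_collection_imp:
  assumes L: "zeck_list L" and \<epsilon>: "\<epsilon> \<in> star_collection L"
  shows "\<epsilon> 0 = 0" "\<epsilon> \<noteq> (\<lambda>_. 0)" "admissible (dig L) (\<lambda>i. \<epsilon> (Suc i))" "recurrent (dig L) (\<lambda>i. \<epsilon> (Suc i))"
proof -
  obtain B where eq: "\<epsilon> = (\<lambda>j. \<Sum>c | c \<in> B \<and> fst c j \<noteq> 0. fst c j)"
    and B: "B \<subseteq> proper_star_blocks L" and disj: "disjoint_supports B" and nz: "\<epsilon> \<noteq> (\<lambda>_. 0)"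
    using \<epsilon> unfolding star_collection_def by blast
  have blk: "\<exists>n k. I = {n..k} \<and> 1 \<le> n \<and> n \<le> k \<and>
     (\<forall>j. j \<notin> {n..k} \<longrightarrow> \<zeta> j = 0) \<and> (\<forall>j. n \<le> j \<and> j < k \<longrightarrow> \<zeta> j = dig L (j - n)) \<and>
     \<zeta> k < dig L (k - n)" if "(\<zeta>, I) \<in> B" for \<zeta> I
    using B that proper_star_block_iff by blast
  have supp: "fst c j = 0" if "c \<in> B" "j \<notin> snd c" for c j
    using blk[of "fst c" "snd c"] that by auto
  have val: "\<epsilon> j = \<zeta> j" if "(\<zeta>, I) \<in> B" "j \<in> I" for \<zeta> I j
    using sum_disjoint_blocks(1)[OF disj supp that(1)] that(2) by (simp add: eq)
  have val0: "\<epsilon> j = 0" if "\<And>c. c \<in> B \<Longrightarrow> j \<notin> snd c" for j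
    using sum_disjoint_blocks(2)[OF disj supp that] by (simp add: eq)
  \<comment> \<open>Only the support intervals are recorded: by disjointness the digits of a block
    are those of \<open>\<epsilon>\<close> on its interval (\<open>val\<close>).\<close>
  define P where "P = {(n, k). n \<le> k \<and> (\<exists>\<zeta>. (\<zeta>, {Suc n..Suc k}) \<in> B)}"
  have "parsed (dig L) {} (\<lambda>i. \<epsilon> (Suc i)) P"
    unfolding parsed_def
  proof (intro conjI)
    show "\<forall>(n, k)\<in>P. n \<le> k \<and> (\<forall>j. n \<le> j \<and> j < k \<longrightarrow> \<epsilon> (Suc j) = dig L (j - n)) \<and>
        (\<epsilon> (Suc k) < dig L (k - n) \<or> k \<in> {} \<and> \<epsilon> (Suc k) = dig L (k - n))"
    proof clarify
      fix n k assume "(n, k) \<in> P"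
      then obtain \<zeta> where \<zeta>: "n \<le> k" "(\<zeta>, {Suc n..Suc k}) \<in> B" by (auto simp: P_def)
      obtain n' k' where nk: "{Suc n..Suc k} = {n'..k'}" "\<forall>j. n' \<le> j \<and> j < k' \<longrightarrow> \<zeta> j = dig L (j - n')"
        "\<zeta> k' < dig L (k' - n')" using blk[OF \<zeta>(2)] by auto
      then have "n' = Suc n" "k' = Suc k" using \<zeta>(1) by (auto simp: Icc_eq_Icc)
      then show "n \<le> k \<and> (\<forall>j. n \<le> j \<and> j < k \<longrightarrow> \<epsilon> (Suc j) = dig L (j - n)) \<and>
        (\<epsilon> (Suc k) < dig L (k - n) \<or> k \<in> {} \<and> \<epsilon> (Suc k) = dig L (k - n))"
        using nk val[OF \<zeta>(2)] \<zeta>(1) by auto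
    qed
    show "\<forall>(n, k)\<in>P. \<forall>(n', k')\<in>P. \<forall>j. j \<in> {n..k} \<and> j \<in> {n'..k'} \<longrightarrow> n = n' \<and> k = k'"
    proof clarify
      fix n k n' k' j assume "(n, k) \<in> P" "(n', k') \<in> P" and j: "j \<in> {n..k}" "j \<in> {n'..k'}"
      then obtain \<zeta> \<zeta>' where z: "(\<zeta>, {Suc n..Suc k}) \<in> B" "(\<zeta>', {Suc n'..Suc k'}) \<in> B"
        by (auto simp: P_def)
      have "Suc j \<in> {Suc n..Suc k} \<inter> {Suc n'..Suc k'}" using j by auto
      then have "{Suc n..Suc k} = {Suc n'..Suc k'}"
        using disj z unfolding disjoint_supports_def pairwise_def by fastforce
      then show "n = n' \<and> k = k'" using j by (auto simp: Icc_eq_Icc)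
    qed
    show "\<forall>j. (\<forall>(n, k)\<in>P. j \<notin> {n..k}) \<longrightarrow> \<epsilon> (Suc j) = 0"
    proof (intro allI impI)
      fix j assume no: "\<forall>(n, k)\<in>P. j \<notin> {n..k}"
      show "\<epsilon> (Suc j) = 0"
      proof (rule val0)
        fix c assume "c \<in> B"
        moreover obtain n k where nk: "snd c = {n..k}" "1 \<le> n" "n \<le> k"
          using blk[of "fst c" "snd c"] \<open>c \<in> B\<close> by auto
        ultimately have "(n - 1, k - 1) \<in> P"
          unfolding P_def by (auto intro!: exI[of _ "fst c"]) (metis prod.collapse)
        with no have "j \<notin> {n - 1..k - 1}" by fast
        then show "Suc j \<notin> snd c" using nk by auto
      qed
    qed
  qed
  then show "admissible (dig L) (\<lambda>i. \<epsilon> (Suc i))" "recurrent (dig L) (\<lambda>i. \<epsilon> (Suc i))"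
    using parsed_admissible_recurrent dig_0_pos[OF L] by blast+
  show "\<epsilon> 0 = 0"
  proof (rule val0)
    show "0 \<notin> snd c" if "c \<in> B" for c
      using blk[of "fst c" "snd c"] that by auto
  qed
qed (use \<epsilon> in \<open>simp add: star_collection_def\<close>)

lemma star_collectionI:
  assumes e0: "\<epsilon> 0 = 0" and nz: "\<epsilon> \<noteq> (\<lambda>_. 0)"
    and adm: "admissible (dig L) (\<lambda>i. \<epsilon> (Suc i))" and rec: "recurrent (dig L) (\<lambda>i. \<epsilon> (Suc i))"
  shows "\<epsilon> \<in> star_collection L"
proof -
  obtain P where P: "parsed (dig L) {} (\<lambda>i. \<epsilon> (Suc i)) P"
    using admissible_parsed[OF adm, of "{}"] rec unfolding recurrent_def by auto
  define blk where "blk = (\<lambda>(n, k). ((\<lambda>j. if j \<in> {Suc n..Suc k} then \<epsilon> j else 0), {Suc n..Suc k}))"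
  define B where "B = blk ` P"
  have 1: "B \<subseteq> proper_star_blocks L"
  proof
    fix c assume "c \<in> B"
    then obtain n k where nk: "(n, k) \<in> P" "c = blk (n, k)" by (auto simp: B_def)
    have "n \<le> k" "\<And>j. n \<le> j \<Longrightarrow> j < k \<Longrightarrow> \<epsilon> (Suc j) = dig L (j - n)" "\<epsilon> (Suc k) < dig L (k - n)"
      using P nk(1) unfolding parsed_def by auto
    then have "\<epsilon> j = dig L (j - Suc n)" if "Suc n \<le> j" "j < Suc k" for j
      using that by (cases j) auto
    then show "c \<in> proper_star_blocks L"
      using \<open>n \<le> k\<close> \<open>\<epsilon> (Suc k) < dig L (k - n)\<close> unfolding nk blk_def prod.case proper_star_block_iff
      by (intro exI[of _ "Suc n"] exI[of _ "Suc k"]) auto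
  qed
  have 2: "disjoint_supports B"
    unfolding disjoint_supports_def pairwise_def
  proof (intro ballI impI)
    fix c c' assume "c \<in> B" "c' \<in> B" "c \<noteq> c'"
    then obtain n k n' k' where nk: "(n, k) \<in> P" "c = blk (n, k)" "(n', k') \<in> P" "c' = blk (n', k')"
      "(n, k) \<noteq> (n', k')" by (auto simp: B_def)
    then have no: "\<not> (j \<in> {n..k} \<and> j \<in> {n'..k'})" for j
      using P unfolding parsed_def by fast
    have "j \<notin> snd c \<inter> snd c'" for j
      using no[of "j - 1"] nk by (auto simp: blk_def)
    then show "snd c \<inter> snd c' = {}" by blast
  qed
  have supp: "fst c j = 0" if "c \<in> B" "j \<notin> snd c" for c j
    using that by (auto simp: B_def blk_def)
  have "\<epsilon> j = (\<Sum>c | c \<in> B \<and> fst c j \<noteq> 0. fst c j)" for j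
  proof (cases "\<exists>c\<in>B. j \<in> snd c")
    case True
    then obtain c where c: "c \<in> B" "j \<in> snd c" by blast
    then show ?thesis using sum_disjoint_blocks(1)[OF 2 supp c] by (auto simp: B_def blk_def)
  next
    case False
    have "\<epsilon> j = 0"
    proof (cases j)
      case (Suc i)
      have "i \<notin> {n..k}" if "(n, k) \<in> P" for n k
        using False that Suc by (auto simp: B_def blk_def)
      then have "\<forall>(n, k)\<in>P. i \<notin> {n..k}" by blast
      then show ?thesis using parsed_zero[OF P] Suc by simp
    qed (use e0 in simp)
    moreover have "(\<Sum>c | c \<in> B \<and> fst c j \<noteq> 0. fst c j) = 0"
      by (rule sum_disjoint_blocks(2)[OF 2 supp]) (use False in auto)
    ultimately show ?thesis by simp
  qed
  then have "\<epsilon> = (\<lambda>j. \<Sum>c | c \<in> B \<and> fst c j \<noteq> 0. fst c j)" by blast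
  then show ?thesis unfolding star_collection_def using 1 2 nz by blast
qed

text \<open>Reading downwards from an index \<open>M\<close> above all supports turns index j into
  position \<open>M - j\<close>. Index 1 becomes position \<open>M - 1\<close>, the only place where
  a full match may close a block, so the parse uses \<open>F = {M - 1}\<close>.\<close>

lemma int_collection_imp_ex:
  assumes L: "zeck_list L" and \<mu>: "\<mu> \<in> int_collection L"
  shows "\<mu> 0 = 0" "\<exists>M. (\<forall>j>M. \<mu> j = 0) \<and> admissible (dig L) (\<lambda>i. rev_cf M \<mu> (Suc i))"
proof -
  obtain B where eq: "\<mu> = (\<lambda>j. \<Sum>c\<in>B. fst c j)" and fin: "finite B"
    and B: "B \<subseteq> max_blocks L \<union> proper_blocks L" and disj: "disjoint_supports B"
    using \<mu> unfolding int_collection_def by blast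
  have blk: "\<exists>k m. I = {k..m} \<and> 1 \<le> k \<and> k \<le> m \<and>
     (\<forall>j. j \<notin> {k..m} \<longrightarrow> \<zeta> j = 0) \<and> (\<forall>j. k < j \<and> j \<le> m \<longrightarrow> \<zeta> j = dig L (m - j)) \<and>
     (\<zeta> k < dig L (m - k) \<or> k = 1 \<and> \<zeta> k = dig L (m - k))" if "(\<zeta>, I) \<in> B" for \<zeta> I
    using B that int_block_iff by blast
  have supp: "fst c j = 0" if "c \<in> B" "j \<notin> snd c" for c j
    using blk[of "fst c" "snd c"] that by auto
  have eq': "\<mu> j = (\<Sum>c | c \<in> B \<and> fst c j \<noteq> 0. fst c j)" for j
    unfolding eq using fin by (intro sum.mono_neutral_right) auto
  have val: "\<mu> j = \<zeta> j" if "(\<zeta>, I) \<in> B" "j \<in> I" for \<zeta> I j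
    using sum_disjoint_blocks(1)[OF disj supp that(1)] that(2) by (simp add: eq')
  have val0: "\<mu> j = 0" if "\<And>c. c \<in> B \<Longrightarrow> j \<notin> snd c" for j
    using sum_disjoint_blocks(2)[OF disj supp that] by (simp add: eq')
  show "\<mu> 0 = 0"
  proof (rule val0)
    show "0 \<notin> snd c" if "c \<in> B" for c
      using blk[of "fst c" "snd c"] that by auto
  qed
  have "finite (snd c)" if "c \<in> B" for c using blk[of "fst c" "snd c"] that by auto
  then have "finite (\<Union>c\<in>B. snd c)" using fin by blast
  then obtain M' where "\<And>j c. c \<in> B \<Longrightarrow> j \<in> snd c \<Longrightarrow> j \<le> M'"
    unfolding finite_nat_set_iff_bounded_le by auto
  then obtain M where M: "\<And>j c. c \<in> B \<Longrightarrow> j \<in> snd c \<Longrightarrow> j \<le> M" "1 \<le> M"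
    by (metis le_SucI le_add1 plus_1_eq_Suc)
  define x where "x = (\<lambda>i. rev_cf M \<mu> (Suc i))"
  have x: "x i = (if i < M then \<mu> (M - i) else 0)" for i by (auto simp: x_def rev_cf_def)
  define P where "P = {(n, k). n \<le> k \<and> k < M \<and> (\<exists>\<zeta>. (\<zeta>, {M - k..M - n}) \<in> B)}"
  have "parsed (dig L) {M - 1} x P"
    unfolding parsed_def
  proof (intro conjI)
    show "\<forall>(n, k)\<in>P. n \<le> k \<and> (\<forall>j. n \<le> j \<and> j < k \<longrightarrow> x j = dig L (j - n)) \<and>
        (x k < dig L (k - n) \<or> k \<in> {M - 1} \<and> x k = dig L (k - n))"
    proof clarify
      fix n k assume "(n, k) \<in> P"
      then obtain \<zeta> where \<zeta>: "n \<le> k" "k < M" "(\<zeta>, {M - k..M - n}) \<in> B" by (auto simp: P_def)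
      obtain k' m where nk: "{M - k..M - n} = {k'..m}" "\<forall>j. k' < j \<and> j \<le> m \<longrightarrow> \<zeta> j = dig L (m - j)"
        "\<zeta> k' < dig L (m - k') \<or> k' = 1 \<and> \<zeta> k' = dig L (m - k')" using blk[OF \<zeta>(3)] by auto
      then have km: "k' = M - k" "m = M - n" using \<zeta>(1,2) by (auto simp: Icc_eq_Icc)
      have "x j = dig L (j - n)" if "n \<le> j" "j < k" for j
      proof -
        have "M - j \<in> {M - k..M - n}" using that by auto
        then have "x j = \<zeta> (M - j)" using val[OF \<zeta>(3)] \<zeta> that by (simp add: x)
        also have "\<dots> = dig L (m - (M - j))" using nk(2)[rule_format, of "M - j"] that km \<zeta> by (simp add: diff_less_mono2)
        also have "m - (M - j) = j - n" using that \<zeta> km by simp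
        finally show ?thesis .
      qed
      moreover have "M - k \<in> {M - k..M - n}" using \<zeta>(1) by auto
      then have "x k = \<zeta> k'" using val[OF \<zeta>(3)] \<zeta> km by (simp add: x)
      moreover have "m - k' = k - n" using km \<zeta> by auto
      ultimately show "n \<le> k \<and> (\<forall>j. n \<le> j \<and> j < k \<longrightarrow> x j = dig L (j - n)) \<and>
        (x k < dig L (k - n) \<or> k \<in> {M - 1} \<and> x k = dig L (k - n))"
        using nk(3) km \<zeta> by auto
    qed
    show "\<forall>(n, k)\<in>P. \<forall>(n', k')\<in>P. \<forall>j. j \<in> {n..k} \<and> j \<in> {n'..k'} \<longrightarrow> n = n' \<and> k = k'"
    proof clarify
      fix n k n' k' j assume nk: "(n, k) \<in> P" "(n', k') \<in> P" and j: "j \<in> {n..k}" "j \<in> {n'..k'}"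
      then obtain \<zeta> \<zeta>' where z: "(\<zeta>, {M - k..M - n}) \<in> B" "(\<zeta>', {M - k'..M - n'}) \<in> B"
        by (auto simp: P_def)
      have "M - j \<in> {M - k..M - n} \<inter> {M - k'..M - n'}" using j by auto
      then have "{M - k..M - n} = {M - k'..M - n'}"
        using disj z unfolding disjoint_supports_def pairwise_def by fastforce
      then show "n = n' \<and> k = k'" using nk by (auto simp: Icc_eq_Icc P_def)
    qed
    show "\<forall>j. (\<forall>(n, k)\<in>P. j \<notin> {n..k}) \<longrightarrow> x j = 0"
    proof (intro allI impI)
      fix j assume no: "\<forall>(n, k)\<in>P. j \<notin> {n..k}"
      have "\<mu> (M - j) = 0" if "j < M"
      proof (rule val0)
        fix c assume "c \<in> B"
        obtain k m where km: "snd c = {k..m}" "1 \<le> k" "k \<le> m"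
          using blk[of "fst c" "snd c"] \<open>c \<in> B\<close> by auto
        have "m \<le> M" using M(1)[OF \<open>c \<in> B\<close>, of m] km by auto
        then have "M - (M - k) = k" "M - (M - m) = m" using km by auto
        then have "(M - m, M - k) \<in> P"
          using km \<open>m \<le> M\<close> \<open>c \<in> B\<close> M(2) unfolding P_def
          by (auto intro!: exI[of _ "fst c"]) (metis prod.collapse)
        with no have "j \<notin> {M - m..M - k}" by fast
        then show "M - j \<notin> snd c" using km that by auto
      qed
      then show "x j = 0" by (simp add: x)
    qed
  qed
  then have "x i \<le> dig L (pstate (dig L) x i)" if "i \<le> M - 1" for i
    using parsed_digit_le[of "dig L" "{M - 1}" x P "M - 1"] dig_0_pos[OF L] that by auto
  moreover have "x i = 0" if "\<not> i \<le> M - 1" for i using that by (simp add: x)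
  ultimately have "admissible (dig L) x" unfolding admissible_def by (metis le0)
  moreover have "\<forall>j>M. \<mu> j = 0"
    using M(1) by (intro allI impI val0) (auto simp: not_less[symmetric])
  ultimately show "\<exists>M. (\<forall>j>M. \<mu> j = 0) \<and> admissible (dig L) (\<lambda>i. rev_cf M \<mu> (Suc i))"
    unfolding x_def by blast
qed

text \<open>The last position always closes a block, with a full match if need be; so admissibility
  alone yields a parse, and recurrence does not enter.\<close>

lemma int_collectionI:
  assumes m0: "\<mu> 0 = 0" and supp\<mu>: "\<forall>j>M. \<mu> j = 0"
    and adm: "admissible (dig L) (\<lambda>i. rev_cf M \<mu> (Suc i))"
  shows "\<mu> \<in> int_collection L"
proof (cases "M = 0")
  case True
  then have "\<mu> j = 0" for j using m0 supp\<mu> by (cases j) auto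
  then have "\<mu> = (\<lambda>j. \<Sum>b\<in>{}. fst b j)" by auto
  then show ?thesis unfolding int_collection_def disjoint_supports_def by fastforce
next
  case False
  define x where "x = (\<lambda>i. rev_cf M \<mu> (Suc i))"
  have x: "x i = (if i < M then \<mu> (M - i) else 0)" for i by (auto simp: x_def rev_cf_def)
  have \<mu>x: "\<mu> j = x (M - j)" if "1 \<le> j" "j \<le> M" for j using that by (simp add: x)
  have "\<exists>P. parsed (dig L) {M - 1} x P \<and> (\<forall>(n, k)\<in>P. \<forall>f\<in>{M - 1}. k \<le> f)"
    by (rule admissible_parsed) (use adm False in \<open>auto simp: x_def[symmetric] x\<close>)
  then obtain P where P: "parsed (dig L) {M - 1} x P" and PM: "\<forall>(n, k)\<in>P. k \<le> M - 1"
    by auto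
  define blk where "blk = (\<lambda>(n, k). ((\<lambda>j. if j \<in> {M - k..M - n} then \<mu> j else 0), {M - k..M - n}))"
  define B where "B = blk ` P"
  have "P \<subseteq> {..M - 1} \<times> {..M - 1}"
  proof clarify
    fix n k assume "(n, k) \<in> P"
    then have "n \<le> k" "k \<le> M - 1" using P PM unfolding parsed_def by auto
    then show "n \<in> {..M - 1} \<and> k \<in> {..M - 1}" by auto
  qed
  then have fin: "finite B" unfolding B_def by (meson finite_SigmaI finite_atMost finite_imageI finite_subset)
  have 1: "B \<subseteq> max_blocks L \<union> proper_blocks L"
  proof
    fix c assume "c \<in> B"
    then obtain n k where nk: "(n, k) \<in> P" "c = blk (n, k)" by (auto simp: B_def)
    then have le: "n \<le> k" "k < M" using P PM False unfolding parsed_def by auto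
    have m: "\<And>j. n \<le> j \<Longrightarrow> j < k \<Longrightarrow> x j = dig L (j - n)"
      and e: "x k < dig L (k - n) \<or> k = M - 1 \<and> x k = dig L (k - n)"
      using P nk(1) unfolding parsed_def by auto
    have "\<mu> j = dig L (M - n - j)" if "M - k < j" "j \<le> M - n" for j
      using m[of "M - j"] \<mu>x[of j] that le by (simp add: diff_diff_eq add.commute)
    moreover have "\<mu> (M - k) < dig L (M - n - (M - k)) \<or> M - k = 1 \<and> \<mu> (M - k) = dig L (M - n - (M - k))"
      using e le by (auto simp: x)
    ultimately show "c \<in> max_blocks L \<union> proper_blocks L"
      using le unfolding nk blk_def prod.case int_block_iff
      by (intro exI[of _ "M - k"] exI[of _ "M - n"]) auto
  qed
  have 2: "disjoint_supports B"
    unfolding disjoint_supports_def pairwise_def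
  proof (intro ballI impI)
    fix c c' assume "c \<in> B" "c' \<in> B" "c \<noteq> c'"
    then obtain n k n' k' where nk: "(n, k) \<in> P" "c = blk (n, k)" "(n', k') \<in> P" "c' = blk (n', k')"
      "(n, k) \<noteq> (n', k')" by (auto simp: B_def)
    then have no: "\<not> (j \<in> {n..k} \<and> j \<in> {n'..k'})" for j
      using P unfolding parsed_def by fast
    have lt: "k < M" "k' < M" "n \<le> k" "n' \<le> k'" using P PM nk False unfolding parsed_def by auto
    show "snd c \<inter> snd c' = {}"
    proof (rule ccontr)
      assume "snd c \<inter> snd c' \<noteq> {}"
      then have "{M - k..M - n} \<inter> {M - k'..M - n'} \<noteq> {}" unfolding nk blk_def by simp
      then obtain j where "j \<in> {M - k..M - n}" "j \<in> {M - k'..M - n'}" by blast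
      then have "M - j \<in> {n..k} \<and> M - j \<in> {n'..k'}" using lt by auto
      then show False using no by blast
    qed
  qed
  have supp: "fst c j = 0" if "c \<in> B" "j \<notin> snd c" for c j
    using that by (auto simp: B_def blk_def)
  have "\<mu> j = (\<Sum>c | c \<in> B \<and> fst c j \<noteq> 0. fst c j)" for j
  proof (cases "\<exists>c\<in>B. j \<in> snd c")
    case True
    then obtain c where c: "c \<in> B" "j \<in> snd c" by blast
    then show ?thesis using sum_disjoint_blocks(1)[OF 2 supp c] by (auto simp: B_def blk_def)
  next
    case no: False
    have "\<mu> j = 0"
    proof (cases "1 \<le> j \<and> j \<le> M")
      case True
      have "M - j \<notin> {n..k}" if "(n, k) \<in> P" for n k
      proof -
        have "j \<notin> {M - k..M - n}" using no that by (force simp: B_def blk_def)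
        then show ?thesis using True by auto
      qed
      then have "\<forall>(n, k)\<in>P. M - j \<notin> {n..k}" by blast
      then have "x (M - j) = 0" using parsed_zero[OF P] by simp
      then show ?thesis using \<mu>x True by auto
    next
      case False
      then show ?thesis using m0 supp\<mu> by (cases "j = 0") auto
    qed
    moreover have "(\<Sum>c | c \<in> B \<and> fst c j \<noteq> 0. fst c j) = 0"
      by (rule sum_disjoint_blocks(2)[OF 2 supp]) (use no in auto)
    ultimately show ?thesis by simp
  qed
  moreover have "(\<Sum>c | c \<in> B \<and> fst c j \<noteq> 0. fst c j) = (\<Sum>c\<in>B. fst c j)" for j
    using fin by (intro sum.mono_neutral_left) auto
  ultimately have "\<mu> = (\<lambda>j. \<Sum>c\<in>B. fst c j)" by auto
  then show ?thesis unfolding int_collection_def using 1 2 fin by blast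
qed

text \<open>Enlarging \<open>M\<close> only prepends zeros, so membership does not depend on the
  bound chosen for the support.\<close>

lemma admissible_rev_cf_mono:
  assumes b0: "0 < b 0" and "\<forall>j>M. \<mu> j = 0" "M \<le> M'"
  shows "admissible b (\<lambda>i. rev_cf M' \<mu> (Suc i)) \<longleftrightarrow> admissible b (\<lambda>i. rev_cf M \<mu> (Suc i))"
  using \<open>M \<le> M'\<close>
proof (induction M' rule: dec_induct)
  case (step m)
  have "(\<lambda>i. rev_cf (Suc m) \<mu> (Suc i)) = case_nat 0 (\<lambda>i. rev_cf m \<mu> (Suc i))"
    using assms(2) step(1) by (auto simp: rev_cf_def fun_eq_iff split: nat.split)
  then show ?case using step admissible_shift[of b, OF b0] by simp
qed simp

lemma int_collection_iff:
  assumes L: "zeck_list L" and M: "\<forall>j>M. \<mu> j = 0"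
  shows "\<mu> \<in> int_collection L \<longleftrightarrow> \<mu> 0 = 0 \<and> admissible (dig L) (\<lambda>i. rev_cf M \<mu> (Suc i))"
proof
  assume \<mu>: "\<mu> \<in> int_collection L"
  then obtain M' where M': "\<forall>j>M'. \<mu> j = 0" "admissible (dig L) (\<lambda>i. rev_cf M' \<mu> (Suc i))"
    using int_collection_imp_ex[OF L] by blast
  have "admissible (dig L) (\<lambda>i. rev_cf M \<mu> (Suc i))"
    using admissible_rev_cf_mono[of "dig L" M \<mu> M'] admissible_rev_cf_mono[of "dig L" M' \<mu> M]
      M M' dig_0_pos[OF L] by (cases "M \<le> M'") auto
  then show "\<mu> 0 = 0 \<and> admissible (dig L) (\<lambda>i. rev_cf M \<mu> (Suc i))"
    using int_collection_imp_ex[OF L \<mu>] by simp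
qed (simp add: int_collectionI[OF _ M])

section \<open>Values of expansions\<close>

definition val :: "real \<Rightarrow> (nat \<Rightarrow> nat) \<Rightarrow> real" where
  "val w x = (\<Sum>k. real (x k) * w ^ Suc k)"

lemma wsum_Qseq: "wsum \<epsilon> (Qseq L) = val (omega L) (\<lambda>i. \<epsilon> (Suc i))"
  by (simp add: wsum_def Qseq_def val_def)

lemma summable_val:
  fixes w :: real
  assumes "0 < w" "w < 1" "\<And>k. x k \<le> C"
  shows "summable (\<lambda>k. real (x k) * w ^ Suc k)"
proof (rule summable_comparison_test')
  show "summable (\<lambda>k. real C * w ^ Suc k)"
    using assms by (intro summable_mult) (simp add: summable_mult)
  show "norm (real (x k) * w ^ Suc k) \<le> real C * w ^ Suc k" if "0 \<le> k" for k
    using assms by (auto simp: abs_mult intro!: mult_mono)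
qed

lemma val_split:
  assumes "0 < w" "w < 1" "\<And>k. x k \<le> C"
  shows "val w x = (\<Sum>k<n. real (x k) * w ^ Suc k) + w ^ n * val w (\<lambda>k. x (n + k))"
proof -
  have "summable (\<lambda>k. real (x (n + k)) * w ^ Suc k)"
    using summable_val[of w "\<lambda>k. x (n + k)" C] assms by simp
  then have "(\<Sum>k. real (x (k + n)) * w ^ Suc (k + n)) = w ^ n * val w (\<lambda>k. x (n + k))"
    unfolding val_def by (subst suminf_mult[symmetric]) (auto simp: power_add mult_ac add.commute)
  then show ?thesis
    unfolding val_def using suminf_split_initial_segment[OF summable_val[of w x C, OF assms], of n] by simp
qed

lemma val_nonneg: "0 < w \<Longrightarrow> w < 1 \<Longrightarrow> (\<And>k. x k \<le> C) \<Longrightarrow> 0 \<le> val w x"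
  unfolding val_def by (intro suminf_nonneg summable_val) auto

lemma val_pos:
  assumes "0 < w" "w < 1" "\<And>k. x k \<le> C" "0 < x i"
  shows "0 < val w x"
  unfolding val_def using assms by (intro suminf_pos2[of _ i] summable_val) auto

lemma val_Suc:
  assumes "0 < w" "w < 1" "\<And>k. x k \<le> C"
  shows "val w x = w * (real (x 0) + val w (\<lambda>k. x (Suc k)))"
  using val_split[of w x C 1, OF assms] by (simp add: algebra_simps)

lemma admissible_bound: "admissible b x \<Longrightarrow> (\<And>s. b s \<le> C) \<Longrightarrow> x k \<le> C"
  unfolding admissible_def using le_trans by blast

text \<open>\<open>val_b\<close> is the series form of the equation for \<open>omega\<close>; it
  makes 1 the bound for all admissible values. \<open>b_inf\<close> keeps every tail of the stream
  positive.\<close>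

locale expansion =
  fixes b :: "nat \<Rightarrow> nat" and w :: real and C :: nat
  assumes b0: "0 < b 0" and b_le: "\<And>s. b s \<le> C" and b_inf: "\<And>s. \<exists>t\<ge>s. 0 < b t"
    and w_pos: "0 < w" and w_less: "w < 1" and val_b: "val w b = 1"
begin

lemmas w = w_pos w_less

text \<open>The largest value of a continuation from state \<open>s\<close>, attained by following
  the stream.\<close>

definition mtail :: "nat \<Rightarrow> real" where
  "mtail s = val w (\<lambda>k. b (s + k))"

lemma mtail_0: "mtail 0 = 1"
  by (simp add: mtail_def val_b)

lemma mtail_rec: "mtail s = w * (real (b s) + mtail (Suc s))"
  using val_Suc[OF w, of "\<lambda>k. b (s + k)" C] b_le by (simp add: mtail_def)

lemma mtail_pos: "0 < mtail s"
proof -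
  obtain t where "t \<ge> s" "0 < b t" using b_inf by blast
  then show ?thesis unfolding mtail_def
    using val_pos[OF w, of "\<lambda>k. b (s + k)" C "t - s"] b_le by simp
qed

text \<open>Matching from some point on would drive the state through all large values, hence
  through one with a positive digit.\<close>

lemma finite_support_recurrent:
  assumes "\<And>j. m \<le> j \<Longrightarrow> x j = 0"
  shows "recurrent b x"
  unfolding recurrent_def
proof (rule allI, rule ccontr)
  fix i assume "\<not> (\<exists>j\<ge>i. x j \<noteq> b (pstate b x j))"
  then have e: "x j = b (pstate b x j)" if "i + m \<le> j" for j using that by auto
  define s where "s = pstate b x (i + m)"
  obtain t where t: "t \<ge> s" "0 < b t" using b_inf by blast
  define j where "j = i + m + (t - s)"
  have "pstate b x j = t"
    using pstate_step[of "i + m" "t - s" x b] e t by (simp add: s_def j_def)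
  moreover have "i + m \<le> j" by (simp add: j_def)
  ultimately show False using e[of j] assms[of j] t by simp
qed

context
  fixes x :: "nat \<Rightarrow> nat"
  assumes adm: "admissible b x"
begin

lemma x_le: "x k \<le> C"
  using admissible_bound[OF adm] b_le by blast

lemma val_tail_Suc: "val w (\<lambda>j. x (k + j)) = w * (real (x k) + val w (\<lambda>j. x (Suc k + j)))"
  using val_Suc[OF w, of "\<lambda>j. x (k + j)" C] x_le by simp

text \<open>Finite sums make induction on the length possible. A match is covered by
  \<open>mtail_rec\<close>; a mismatch lowers the digit by at least 1 and resets the state, and the
  given-up unit pays for the new tail, which is at most \<open>mtail 0 = 1\<close>.\<close>

lemma partial_tail_le: "(\<Sum>j<n. real (x (k + j)) * w ^ Suc j) \<le> mtail (pstate b x k)"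
proof (induction n arbitrary: k)
  case 0
  then show ?case using mtail_pos[of "pstate b x k"] by simp
next
  case (Suc n)
  have "(\<Sum>j<Suc n. real (x (k + j)) * w ^ Suc j) =
      w * (real (x k) + (\<Sum>j<n. real (x (Suc k + j)) * w ^ Suc j))"
    by (subst sum.lessThan_Suc_shift) (simp add: algebra_simps sum_distrib_left)
  also have "\<dots> \<le> w * (real (x k) + mtail (pstate b x (Suc k)))"
    using Suc[of "Suc k"] w by (intro mult_left_mono) auto
  also have "\<dots> \<le> w * (real (b (pstate b x k)) + mtail (Suc (pstate b x k)))"
  proof (cases "x k = b (pstate b x k)")
    case False
    then have "real (x k) + 1 \<le> real (b (pstate b x k))"
      using adm unfolding admissible_def
      by (metis Suc_leI le_neq_implies_less of_nat_Suc of_nat_mono add.commute)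
    then show ?thesis
      using False mtail_0 mtail_pos[of "Suc (pstate b x k)"] w by (intro mult_left_mono) auto
  qed simp
  finally show ?case by (simp add: mtail_rec[symmetric])
qed

lemma val_tail_le: "val w (\<lambda>j. x (k + j)) \<le> mtail (pstate b x k)"
  unfolding val_def using summable_val[OF w, of "\<lambda>j. x (k + j)" C] x_le
  by (intro suminf_le_const) (use partial_tail_le in auto)

lemma val_le_1: "val w x \<le> 1"
  using val_tail_le[of 0] mtail_0 by simp

text \<open>Backward induction from the mismatch: there the given-up unit pays for the tail, while
  the positive \<open>mtail\<close> of the next state is forgone altogether. The strict inequality
  is then passed down to \<open>k\<close>.\<close>

lemma val_tail_less:
  assumes i: "k \<le> i" "x i \<noteq> b (pstate b x i)"
  shows "val w (\<lambda>j. x (k + j)) < mtail (pstate b x k)"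
proof -
  from i(1) show ?thesis
  proof (induction k rule: inc_induct)
    case base
    then have *: "real (x i) + 1 \<le> real (b (pstate b x i))"
      using adm i(2) unfolding admissible_def
      by (metis Suc_leI le_neq_implies_less of_nat_Suc of_nat_mono add.commute)
    have "val w (\<lambda>j. x (Suc i + j)) \<le> 1"
      using val_tail_le[of "Suc i"] i(2) mtail_0 by simp
    with * have "real (x i) + val w (\<lambda>j. x (Suc i + j)) < real (b (pstate b x i)) + mtail (Suc (pstate b x i))"
      using mtail_pos[of "Suc (pstate b x i)"] by linarith
    then show ?case using w by (subst val_tail_Suc, subst mtail_rec) auto
  next
    case (step k)
    show ?case
    proof (cases "x k = b (pstate b x k)")
      case True
      then show ?thesis
        using step w by (subst val_tail_Suc, subst mtail_rec) auto
    next
      case False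
      then have *: "real (x k) + 1 \<le> real (b (pstate b x k))"
        using adm unfolding admissible_def
        by (metis Suc_leI le_neq_implies_less of_nat_Suc of_nat_mono add.commute)
      have "real (x k) + val w (\<lambda>j. x (Suc k + j)) < real (b (pstate b x k)) + mtail (Suc (pstate b x k))"
        using * step False mtail_0 mtail_pos[of "Suc (pstate b x k)"] by auto
      then show ?thesis using w by (subst val_tail_Suc, subst mtail_rec) auto
    qed
  qed
qed

end

lemma val_less_1: "admissible b x \<Longrightarrow> x i \<noteq> b (pstate b x i) \<Longrightarrow> val w x < 1"
  using val_tail_less[of x 0 i] mtail_0 by simp

text \<open>Up to the first difference the states agree, so the smaller digit is a mismatch.
  Afterwards \<open>x\<close> is in state 0, where recurrence keeps its tail strictly below one
  unit.\<close>

lemma val_strict_mono: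
  assumes x: "admissible b x" "recurrent b x" and y: "admissible b y"
    and i: "x i < y i" "\<And>j. j < i \<Longrightarrow> x j = y j"
  shows "val w x < val w y"
proof -
  have "pstate b x i = pstate b y i" using i(2) by (rule pstate_cong)
  then have "x i \<noteq> b (pstate b x i)" using y i(1) unfolding admissible_def by (metis not_le)
  then have "val w (\<lambda>j. x (Suc i + j)) < 1"
    using val_tail_less[OF x(1), of "Suc i"] x(2) mtail_0 unfolding recurrent_def by fastforce
  moreover have "0 \<le> val w (\<lambda>j. y (Suc i + j))"
    using val_nonneg[OF w, of "\<lambda>j. y (Suc i + j)" C] x_le[OF y] by blast
  ultimately have "real (x i) + val w (\<lambda>j. x (Suc i + j)) < real (y i) + val w (\<lambda>j. y (Suc i + j))"
    using i(1) by linarith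
  then have "w ^ i * val w (\<lambda>j. x (i + j)) < w ^ i * val w (\<lambda>j. y (i + j))"
    using w by (subst (1 2) val_tail_Suc) (auto simp: x y)
  moreover have "(\<Sum>k<i. real (x k) * w ^ Suc k) = (\<Sum>k<i. real (y k) * w ^ Suc k)"
    using i(2) by (intro sum.cong) auto
  ultimately show ?thesis
    using val_split[OF w, of x C i] val_split[OF w, of y C i] x_le[OF x(1)] x_le[OF y] by simp
qed

lemma val_inj:
  assumes "admissible b x" "recurrent b x" "admissible b y" "recurrent b y" "val w x = val w y"
  shows "x = y"
proof (rule ccontr)
  assume "x \<noteq> y"
  then obtain i where i: "x i \<noteq> y i" "\<And>j. j < i \<Longrightarrow> x j = y j"
    using exists_least_iff[of "\<lambda>i. x i \<noteq> y i"] by auto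
  show False
  proof (cases "x i < y i")
    case True
    then show False using val_strict_mono[of x y i] i(2) assms by simp
  next
    case False
    then have "y i < x i" using i(1) by simp
    then show False using val_strict_mono[of y x i] i(2) assms by simp
  qed
qed

text \<open>The pair holds the state and the remainder, rescaled by \<open>1 / w\<close> at each
  step. The cap \<open>b s\<close> matters: since \<open>mtail\<close> can exceed 1, the remainder
  may leave room for a digit larger than the stream allows.\<close>

primrec greedy :: "real \<Rightarrow> nat \<Rightarrow> nat \<times> real" where
  "greedy r 0 = (0, r)"
| "greedy r (Suc k) = (let (s, q) = greedy r k; d = min (nat \<lfloor>q / w\<rfloor>) (b s)
     in (if d = b s then Suc s else 0, q / w - real d))"

text \<open>The invariant is \<open>0 \<le> q k < mtail (s k)\<close>: a digit equal to the cap
  leaves less than the next \<open>mtail\<close>, a smaller one less than 1 =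
  \<open>mtail 0\<close>. Its strictness also gives recurrence, since matching forever would force
  equality.\<close>

lemma val_surj:
  assumes r: "0 \<le> r" "r < 1"
  shows "\<exists>x. admissible b x \<and> recurrent b x \<and> val w x = r"
proof -
  define s where "s k = fst (greedy r k)" for k
  define q where "q k = snd (greedy r k)" for k
  define x where "x k = min (nat \<lfloor>q k / w\<rfloor>) (b (s k))" for k
  have s0: "s 0 = 0" "q 0 = r" by (simp_all add: s_def q_def)
  have sS: "s (Suc k) = (if x k = b (s k) then Suc (s k) else 0)" and qS: "q (Suc k) = q k / w - real (x k)" for k
    by (simp_all add: s_def q_def x_def case_prod_beta Let_def)
  have st: "pstate b x k = s k" for k
    by (induction k) (simp_all add: s0 sS)
  have adm: "admissible b x" unfolding admissible_def st by (simp add: x_def)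
  have inv: "0 \<le> q k \<and> q k < mtail (s k)" for k
  proof (induction k)
    case 0
    then show ?case using r by (simp add: s0 mtail_0)
  next
    case (Suc k)
    have nn: "0 \<le> q k / w" using Suc w by simp
    have "real (x k) \<le> real (nat \<lfloor>q k / w\<rfloor>)" by (simp add: x_def)
    also have "\<dots> \<le> q k / w" using nn by simp
    finally have "0 \<le> q (Suc k)" by (simp add: qS)
    moreover have "q (Suc k) < mtail (s (Suc k))"
    proof (cases "x k = b (s k)")
      case True
      have "q k / w < mtail (s k) / w" using Suc w by (simp add: divide_strict_right_mono)
      also have "\<dots> = real (b (s k)) + mtail (Suc (s k))"
        using w by (subst mtail_rec) auto
      finally show ?thesis using True by (simp add: qS sS)
    next
      case False
      then have "x k = nat \<lfloor>q k / w\<rfloor>" by (auto simp: x_def min_def split: if_splits)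
      then have "q k / w < real (x k) + 1" using nn by simp
      then show ?thesis using False by (simp add: qS sS mtail_0)
    qed
    ultimately show ?case by blast
  qed
  have tail: "q i = (\<Sum>j<n. real (x (i + j)) * w ^ Suc j) + w ^ n * q (i + n)" for i n
  proof (induction n)
    case (Suc n)
    have "q (i + n) = w * (real (x (i + n)) + q (i + Suc n))" using w by (simp add: qS)
    then show ?case using Suc by (simp add: algebra_simps)
  qed simp
  \<comment> \<open>A common bound for all \<open>mtail\<close>, hence for all remainders, so that
    the error \<open>w ^ n * q (i + n)\<close> tends to 0.\<close>
  define K where "K = val w (\<lambda>_. C)"
  have K: "mtail i \<le> K" for i
    unfolding K_def mtail_def val_def using w b_le
    by (intro suminf_le summable_val[OF w, of _ C] mult_right_mono) auto
  have val_q: "val w (\<lambda>j. x (i + j)) = q i" for i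
  proof -
    have z: "(\<lambda>n. w ^ n * K) \<longlonglongrightarrow> 0"
      using w by (intro tendsto_mult_left_zero LIMSEQ_power_zero) auto
    have "(\<lambda>n. w ^ n * q (i + n)) \<longlonglongrightarrow> 0"
    proof (rule tendsto_sandwich[OF _ _ tendsto_const z])
      show "\<forall>\<^sub>F n in sequentially. 0 \<le> w ^ n * q (i + n)" using inv w by simp
      show "\<forall>\<^sub>F n in sequentially. w ^ n * q (i + n) \<le> w ^ n * K"
      proof (intro always_eventually allI mult_left_mono)
        show "q (i + n) \<le> K" for n using inv[of "i + n"] K[of "s (i + n)"] by linarith
      qed (use w in auto)
    qed
    then have "(\<lambda>n. q i - w ^ n * q (i + n)) \<longlonglongrightarrow> q i - 0" by (intro tendsto_intros)
    moreover have "(\<lambda>n. q i - w ^ n * q (i + n)) = (\<lambda>n. \<Sum>j<n. real (x (i + j)) * w ^ Suc j)"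
      using tail[of i] by (auto simp: algebra_simps)
    ultimately have "(\<lambda>j. real (x (i + j)) * w ^ Suc j) sums q i" by (simp add: sums_def)
    then show ?thesis unfolding val_def by (simp add: sums_iff)
  qed
  have "recurrent b x"
    unfolding recurrent_def
  proof (rule allI, rule ccontr)
    fix i assume "\<not> (\<exists>j\<ge>i. x j \<noteq> b (pstate b x j))"
    then have e: "x j = b (pstate b x j)" if "i \<le> j" for j using that by auto
    have "x (i + j) = b (s i + j)" for j
      using e[of "i + j"] pstate_step[of i j x b] e by (simp add: st)
    then have "q i = mtail (s i)" using val_q[of i] by (simp add: mtail_def)
    then show False using inv[of i] by simp
  qed
  then show ?thesis using adm val_q[of 0] s0 by auto
qed

end

text \<open>Division by the leading power turns the polynomial into a sum of powers of 1/x with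
  non-negative coefficients, whose monotonicity is evident.\<close>

lemma poly_zeck_poly:
  assumes "zeck_list L" "0 < x"
  shows "poly (zeck_poly L) x = 0 \<longleftrightarrow>
    (\<Sum>k<length L. real (L ! k) * (1 / x) ^ Suc k) + (1 / x) ^ length L = 1"
proof -
  obtain m where m: "length L = Suc m" using assms unfolding zeck_list_def by (cases "length L") auto
  have "poly (zeck_poly L) x = x ^ Suc m - (\<Sum>k<m. real (L ! k) * x ^ (m - k)) - (1 + real (L ! m))"
    unfolding zeck_poly_def Let_def m
    by (simp add: poly_sum poly_monom sum.atLeast1_atMost_eq)
  also have "\<dots> = x ^ Suc m * (1 - ((\<Sum>k<Suc m. real (L ! k) * (1 / x) ^ Suc k) + (1 / x) ^ Suc m))"
  proof -
    have "x ^ Suc m * (real (L ! k) * (1 / x) ^ Suc k) = real (L ! k) * x ^ (m - k)" if "k \<le> m" for k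
    proof -
      have "x ^ Suc m = x ^ Suc k * x ^ (m - k)" using that by (simp flip: power_add)
      then show ?thesis using assms(2) by (simp add: power_one_over)
    qed
    then have "x ^ Suc m * (\<Sum>k<Suc m. real (L ! k) * (1 / x) ^ Suc k) =
        (\<Sum>k<Suc m. real (L ! k) * x ^ (m - k))"
      unfolding sum_distrib_left by (intro sum.cong) auto
    moreover have "x ^ Suc m * (1 / x) ^ Suc m = 1" using assms(2) by (simp add: power_one_over)
    ultimately show ?thesis
      by (simp only: distrib_left right_diff_distrib) simp
  qed
  finally have "poly (zeck_poly L) x =
      x ^ Suc m * (1 - ((\<Sum>k<Suc m. real (L ! k) * (1 / x) ^ Suc k) + (1 / x) ^ Suc m))" .
  then show ?thesis using assms(2) unfolding m by auto
qed

text \<open>The function \<open>h\<close> increases strictly from 0 to a value above 1, the latter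
  because \<open>L ! 0\<close> is positive; so it takes the value 1 exactly once, which resolves the
  description in \<open>phi\<close>.\<close>

lemma omega_root:
  assumes L: "zeck_list L"
  shows "0 < omega L" "omega L < 1"
    "(\<Sum>k<length L. real (L ! k) * omega L ^ Suc k) + omega L ^ length L = 1"
proof -
  define h :: "real \<Rightarrow> real" where "h z = (\<Sum>k<length L. real (L ! k) * z ^ Suc k) + z ^ length L" for z
  have N: "0 < length L" "0 < L ! 0" using L by (auto simp: zeck_list_def)
  have mono: "h z < h z'" if "0 \<le> z" "z < z'" for z z'
    unfolding h_def using that N
    by (intro add_le_less_mono sum_mono mult_left_mono power_mono power_strict_mono) auto
  have "(\<Sum>k\<in>{0}. real (L ! k)) \<le> (\<Sum>k<length L. real (L ! k))"
    using N by (intro sum_mono2) auto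
  then have h1: "1 < h 1" using N by (simp add: h_def)
  have h0: "h 0 = 0" using N by (simp add: h_def)
  have "\<exists>z. 0 \<le> z \<and> z \<le> 1 \<and> h z = 1"
  proof (rule IVT)
    show "\<forall>x. 0 \<le> x \<and> x \<le> 1 \<longrightarrow> isCont h x"
      unfolding h_def by (intro allI impI continuous_intros)
  qed (use h0 h1 in auto)
  then obtain z where z: "0 \<le> z" "z \<le> 1" "h z = 1" by blast
  with h0 h1 have z01: "0 < z" "z < 1" by (auto simp: less_le)
  have "phi L = 1 / z"
    unfolding phi_def
  proof (rule the_equality)
    show "0 < 1 / z \<and> poly (zeck_poly L) (1 / z) = 0"
      using poly_zeck_poly[OF L, of "1 / z"] z z01 by (simp add: h_def)
    show "x = 1 / z" if "0 < x \<and> poly (zeck_poly L) x = 0" for x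
    proof -
      have "h (1 / x) = 1" using poly_zeck_poly[OF L, of x] that by (simp add: h_def)
      then have "1 / x = z"
        using mono[of "1 / x" z] mono[of z "1 / x"] z that by (cases "1 / x" z rule: linorder_cases) auto
      then show ?thesis using that by auto
    qed
  qed
  then have "omega L = z" by (simp add: omega_def)
  then show "0 < omega L" "omega L < 1"
    "(\<Sum>k<length L. real (L ! k) * omega L ^ Suc k) + omega L ^ length L = 1"
    using z z01 by (simp_all add: h_def)
qed

lemma dig_le: "zeck_list L \<Longrightarrow> dig L s \<le> Max (set L)"
  unfolding dig_def zeck_list_def by (intro Max_ge) (auto intro!: nth_mem mod_less_divisor)

text \<open>By periodicity the value V of the stream satisfies V = (1 - w^N) + w^N V, where w is the
  base and N the length of the list; hence V = 1.\<close>

lemma expansion_dig: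
  assumes L: "zeck_list L"
  shows "expansion (dig L) (omega L) (Max (set L))"
proof
  note w = omega_root(1,2)[OF L]
  have N: "0 < length L" using L by (auto simp: zeck_list_def)
  show "\<exists>t\<ge>s. 0 < dig L t" for s
    using N dig_0_pos[OF L] by (intro exI[of _ "s * length L"]) (simp add: dig_def Suc_le_eq)
  let ?v = "val (omega L) (dig L)" and ?N = "length L"
  have "dig L (?N + k) = dig L k" for k by (simp add: dig_def)
  then have "?v = (\<Sum>k<?N. real (dig L k) * omega L ^ Suc k) + omega L ^ ?N * ?v"
    using val_split[OF w, of "dig L" "Max (set L)" ?N] dig_le[OF L] by simp
  also have "(\<Sum>k<?N. real (dig L k) * omega L ^ Suc k) = 1 - omega L ^ ?N"
    using omega_root(3)[OF L] by (simp add: dig_def algebra_simps)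
  finally have "(1 - omega L ^ ?N) * (?v - 1) = 0" by (simp add: algebra_simps)
  moreover have "omega L ^ ?N < 1" using w N by (simp add: power_less_one_iff)
  ultimately show "?v = 1" by simp
qed (use L dig_0_pos dig_le omega_root in auto)

section \<open>The least admissible expansion above a given one\<close>

lemma less_a_irrefl: "\<not> less_a \<mu> \<mu>"
  by (simp add: less_a_def)

lemma less_a_trans:
  assumes "less_a \<mu> \<nu>" "less_a \<nu> \<xi>"
  shows "less_a \<mu> \<xi>"
proof -
  obtain k l where k: "\<mu> k < \<nu> k" "\<forall>j>k. \<mu> j = \<nu> j" and l: "\<nu> l < \<xi> l" "\<forall>j>l. \<nu> j = \<xi> j"
    using assms unfolding less_a_def by blast
  show ?thesis
    unfolding less_a_def by (rule exI[of _ "max k l"], cases k l rule: linorder_cases) (use k l in auto)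
qed

lemma less_a_total:
  assumes "\<forall>j>M. \<mu> j = 0" "\<forall>j>M'. \<nu> j = 0" "\<mu> \<noteq> \<nu>"
  shows "less_a \<mu> \<nu> \<or> less_a \<nu> \<mu>"
proof -
  let ?D = "{j. \<mu> j \<noteq> \<nu> j}"
  have "?D \<subseteq> {..max M M'}" using assms(1,2) by (auto simp: not_le intro: ccontr)
  then have fin: "finite ?D" by (rule finite_subset) simp
  have ne: "?D \<noteq> {}" using assms(3) by auto
  define m where "m = Max ?D"
  have above: "\<mu> j = \<nu> j" if "m < j" for j using Max_ge[OF fin, of j] that unfolding m_def by force
  have "\<mu> m \<noteq> \<nu> m" using Max_in[OF fin ne] unfolding m_def by simp
  then consider "\<mu> m < \<nu> m" | "\<nu> m < \<mu> m" by linarith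
  then show ?thesis
  proof cases
    case 1
    then have "less_a \<mu> \<nu>" unfolding less_a_def using above by (intro exI[of _ m]) simp
    then show ?thesis ..
  next
    case 2
    then have "less_a \<nu> \<mu>" unfolding less_a_def using above by (intro exI[of _ m]) simp
    then show ?thesis ..
  qed
qed

lemma less_a_total_int_collection:
  assumes "zeck_list L" "\<mu> \<in> int_collection L" "\<nu> \<in> int_collection L" "\<mu> \<noteq> \<nu>"
  shows "less_a \<mu> \<nu> \<or> less_a \<nu> \<mu>"
  using int_collection_imp_ex(2)[OF assms(1,2)] int_collection_imp_ex(2)[OF assms(1,3)]
    less_a_total assms(4) by blast

lemma zero_in_int_collection: "(\<lambda>_. 0) \<in> int_collection L"
  by (rule int_collectionI[of _ 0]) (auto simp: admissible_def rev_cf_def)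

text \<open>A member below \<open>\<mu>\<close> has no index above \<open>M\<close> in its support,
  and its digits are bounded by the largest entry of the list.\<close>

lemma finite_int_collection_less_a:
  assumes L: "zeck_list L" and M: "\<forall>j>M. \<mu> j = 0"
  shows "finite {\<nu> \<in> int_collection L. less_a \<nu> \<mu>}"
proof (rule finite_subset)
  let ?C = "Max (set L)"
  show "finite {\<nu>. \<forall>j. (j \<in> {..M} \<longrightarrow> \<nu> j \<in> {..?C}) \<and> (j \<notin> {..M} \<longrightarrow> \<nu> j = (0::nat))}"
    by (rule finite_set_of_finite_funs) auto
  show "{\<nu> \<in> int_collection L. less_a \<nu> \<mu>} \<subseteq>
    {\<nu>. \<forall>j. (j \<in> {..M} \<longrightarrow> \<nu> j \<in> {..?C}) \<and> (j \<notin> {..M} \<longrightarrow> \<nu> j = 0)}"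
  proof clarify
    fix \<nu> j assume \<nu>: "\<nu> \<in> int_collection L" "less_a \<nu> \<mu>"
    then obtain k where k: "\<nu> k < \<mu> k" "\<forall>j>k. \<nu> j = \<mu> j" unfolding less_a_def by blast
    have "k \<le> M" using k(1) M by (metis not_le not_less_zero)
    then have supp: "\<forall>j>M. \<nu> j = 0" using k(2) M by auto
    have \<nu>0: "\<nu> 0 = 0" and adm: "admissible (dig L) (\<lambda>i. rev_cf M \<nu> (Suc i))"
      using int_collection_iff[OF L supp] \<nu>(1) by auto
    have "\<nu> j \<le> ?C" if "j \<le> M"
    proof (cases "j = 0")
      case False
      then have "rev_cf M \<nu> (Suc (M - j)) = \<nu> j" using that by (simp add: rev_cf_def)
      then show ?thesis using admissible_bound[OF adm, of ?C "M - j"] dig_le[OF L] by simp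
    qed (simp add: \<nu>0)
    then show "(j \<in> {..M} \<longrightarrow> \<nu> j \<in> {..?C}) \<and> (j \<notin> {..M} \<longrightarrow> \<nu> j = 0)" using supp by auto
  qed
qed

text \<open>Only finitely many members lie below \<open>\<mu>\<close>, and 0 is one of them, so a
  largest one exists and equals \<open>check_cf L \<mu>\<close>. By \<open>gap\<close> no member
  lies strictly between it and \<open>\<eta>\<close>. Thus \<open>bar_cf\<close> yields the least
  member not below \<open>\<mu>\<close>.\<close>

lemma bar_cf_eq:
  assumes L: "zeck_list L" and M: "\<forall>j>M. \<mu> j = 0" and nz: "\<mu> \<noteq> (\<lambda>_. 0)"
    and \<eta>: "\<eta> \<in> int_collection L" "\<eta> = \<mu> \<or> less_a \<mu> \<eta>"
    and gap: "\<And>\<xi>. \<xi> \<in> int_collection L \<Longrightarrow> less_a \<xi> \<eta> \<Longrightarrow> less_a \<xi> \<mu>"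
  shows "bar_cf L \<mu> = \<eta>"
proof -
  let ?S = "{\<nu> \<in> int_collection L. less_a \<nu> \<mu>}"
  have "\<not> less_a \<mu> (\<lambda>_. 0)" by (simp add: less_a_def)
  then have "(\<lambda>_. 0) \<in> ?S"
    using less_a_total[OF M, of 0 "\<lambda>_. 0"] nz zero_in_int_collection by blast
  moreover have "transp_on ?S less_a" "asymp_on ?S less_a"
    by (auto intro!: transp_onI asymp_onI dest: less_a_trans simp: less_a_irrefl)
  ultimately obtain m where m: "m \<in> ?S" "\<forall>x\<in>?S. x \<noteq> m \<longrightarrow> \<not> less_a m x"
    using Finite_Set.bex_max_element[OF finite_int_collection_less_a[OF L M], of less_a] by blast
  have max: "\<xi> = m \<or> less_a \<xi> m" if "\<xi> \<in> int_collection L" "less_a \<xi> \<mu>" for \<xi>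
    using m that less_a_total_int_collection[OF L, of \<xi> m] by blast
  have check: "check_cf L \<mu> = m"
    unfolding check_cf_def
  proof (rule the_equality)
    show "m \<in> int_collection L \<and> less_a m \<mu> \<and>
      (\<forall>\<xi>\<in>int_collection L. less_a \<xi> \<mu> \<longrightarrow> \<xi> = m \<or> less_a \<xi> m)" using m max by blast
    show "\<nu> = m" if "\<nu> \<in> int_collection L \<and> less_a \<nu> \<mu> \<and>
      (\<forall>\<xi>\<in>int_collection L. less_a \<xi> \<mu> \<longrightarrow> \<xi> = \<nu> \<or> less_a \<xi> \<nu>)" for \<nu>
      using that m max[of \<nu>] less_a_trans[of m \<nu> m] less_a_irrefl[of m] by blast
  qed
  have m\<eta>: "less_a m \<eta>" using m(1) \<eta>(2) less_a_trans by blast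
  have least: "\<xi> = \<eta> \<or> less_a \<eta> \<xi>" if "\<xi> \<in> int_collection L" "less_a m \<xi>" for \<xi>
  proof (rule ccontr)
    assume "\<not> (\<xi> = \<eta> \<or> less_a \<eta> \<xi>)"
    then have "less_a \<xi> \<mu>" using gap less_a_total_int_collection[OF L that(1) \<eta>(1)] that(1) by blast
    then show False using max[OF that(1)] that(2) less_a_trans less_a_irrefl by blast
  qed
  show ?thesis
    unfolding bar_cf_def check
  proof (rule the_equality)
    show "\<eta> \<in> int_collection L \<and> less_a m \<eta> \<and>
      (\<forall>\<xi>\<in>int_collection L. less_a m \<xi> \<longrightarrow> \<xi> = \<eta> \<or> less_a \<eta> \<xi>)" using \<eta> m\<eta> least by blast
    show "\<nu> = \<eta>" if "\<nu> \<in> int_collection L \<and> less_a m \<nu> \<and>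
      (\<forall>\<xi>\<in>int_collection L. less_a m \<xi> \<longrightarrow> \<xi> = \<nu> \<or> less_a \<nu> \<xi>)" for \<nu>
      using that \<eta>(1) m\<eta> least[of \<nu>] less_a_trans[of \<nu> \<eta> \<nu>] less_a_irrefl[of \<nu>] by blast
  qed
qed

section \<open>Truncation and reversal of infinite expansions\<close>

definition trunc :: "nat \<Rightarrow> (nat \<Rightarrow> nat) \<Rightarrow> nat \<Rightarrow> nat" where
  "trunc m x = (\<lambda>i. if i < m then x i else 0)"

lemma admissible_trunc:
  assumes "admissible b x"
  shows "admissible b (trunc m x)"
  unfolding admissible_def
proof
  fix i
  show "trunc m x i \<le> b (pstate b (trunc m x) i)"
  proof (cases "i < m")
    case True
    then have "pstate b (trunc m x) i = pstate b x i"
      by (intro pstate_cong) (auto simp: trunc_def)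
    then show ?thesis using assms True by (simp add: admissible_def trunc_def)
  qed (simp add: trunc_def)
qed

lemma admissible_if_trunc:
  assumes "\<And>m. admissible b (trunc m x)"
  shows "admissible b x"
  unfolding admissible_def
proof
  fix i
  have "pstate b (trunc (Suc i) x) i = pstate b x i"
    by (intro pstate_cong) (auto simp: trunc_def)
  then show "x i \<le> b (pstate b x i)"
    using assms[of "Suc i"] unfolding admissible_def by (auto simp: trunc_def dest: spec[of _ i])
qed

lemma rev_rev_cf: "rev_cf n (rev_cf n \<epsilon>) k = (if 1 \<le> k \<and> k \<le> n then \<epsilon> k else 0)"
  by (auto simp: rev_cf_def)

lemma rev_cf_in_int_collection_iff:
  assumes "zeck_list L"
  shows "rev_cf n \<epsilon> \<in> int_collection L \<longleftrightarrow> admissible (dig L) (trunc n (\<lambda>i. \<epsilon> (Suc i)))"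
proof -
  have "(\<lambda>i. rev_cf n (rev_cf n \<epsilon>) (Suc i)) = trunc n (\<lambda>i. \<epsilon> (Suc i))"
    by (auto simp: rev_rev_cf trunc_def)
  then show ?thesis
    using int_collection_iff[OF assms, of n "rev_cf n \<epsilon>"] by (simp add: rev_cf_def)
qed

text \<open>Reversal puts the leading digit at index \<open>n\<close>, so \<open>less_a\<close>
  becomes lexicographic comparison from the front.\<close>

lemma less_a_rev_cf_iff:
  "less_a \<xi> (rev_cf n \<epsilon>) \<longleftrightarrow> (\<forall>j>n. \<xi> j = 0) \<and>
     (\<exists>i<n. \<xi> (n - i) < \<epsilon> (Suc i) \<and> (\<forall>j<i. \<xi> (n - j) = \<epsilon> (Suc j)))"
proof
  assume "less_a \<xi> (rev_cf n \<epsilon>)"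
  then obtain k where k: "\<xi> k < rev_cf n \<epsilon> k" "\<And>j. k < j \<Longrightarrow> \<xi> j = rev_cf n \<epsilon> j"
    unfolding less_a_def by blast
  then have kn: "1 \<le> k" "k \<le> n" by (auto simp: rev_cf_def split: if_splits)
  have "\<xi> (n - (n - k)) < \<epsilon> (Suc (n - k))" using k(1) kn by (simp add: rev_cf_def Suc_diff_le)
  moreover have "\<xi> (n - j) = \<epsilon> (Suc j)" if "j < n - k" for j
    using k(2)[of "n - j"] kn that by (simp add: rev_cf_def)
  moreover have "\<xi> j = 0" if "n < j" for j using k(2)[of j] kn that by (simp add: rev_cf_def)
  moreover have "n - k < n" using kn by simp
  ultimately show "(\<forall>j>n. \<xi> j = 0) \<and>
     (\<exists>i<n. \<xi> (n - i) < \<epsilon> (Suc i) \<and> (\<forall>j<i. \<xi> (n - j) = \<epsilon> (Suc j)))" by blast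
next
  assume *: "(\<forall>j>n. \<xi> j = 0) \<and>
     (\<exists>i<n. \<xi> (n - i) < \<epsilon> (Suc i) \<and> (\<forall>j<i. \<xi> (n - j) = \<epsilon> (Suc j)))"
  then obtain i where i: "i < n" "\<xi> (n - i) < \<epsilon> (Suc i)" "\<And>j. j < i \<Longrightarrow> \<xi> (n - j) = \<epsilon> (Suc j)" by blast
  have "\<xi> (n - i) < rev_cf n \<epsilon> (n - i)" using i by (simp add: rev_cf_def)
  moreover have "\<xi> j = rev_cf n \<epsilon> j" if "n - i < j" for j
  proof (cases "j \<le> n")
    case True
    then have "\<xi> j = \<epsilon> (Suc (n - j))" using i(3)[of "n - j"] that i(1) by simp
    then show ?thesis using True that by (simp add: rev_cf_def Suc_diff_le)
  qed (use * in \<open>simp add: rev_cf_def\<close>)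
  ultimately show "less_a \<xi> (rev_cf n \<epsilon>)" unfolding less_a_def by blast
qed

lemma rev_bar_eqI:
  assumes not_ge: "\<not> (\<epsilon> = beta_bar L 1 \<or> less_d (beta_bar L 1) \<epsilon>)"
    and ev: "\<And>n. k < n \<Longrightarrow> bar_cf L (rev_cf n \<epsilon>) = rev_cf n \<eta>" and "\<eta> 0 = 0"
  shows "rev_bar L \<epsilon> = \<eta>"
proof
  fix j
  have "\<forall>\<^sub>F n in sequentially. rev_cf n (bar_cf L (rev_cf n \<epsilon>)) j = \<eta> j"
    \<comment> \<open>Beyond \<open>k\<close> the hypothesis \<open>ev\<close> applies; beyond
      \<open>j\<close> the entry survives the cut at \<open>n\<close>.\<close>
    using eventually_gt_at_top[of "max j k"]
  proof eventually_elim
    case (elim n)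
    then show ?case using ev[of n] \<open>\<eta> 0 = 0\<close> by (cases "j = 0") (simp_all add: rev_rev_cf)
  qed
  then have "lim (\<lambda>n. rev_cf n (bar_cf L (rev_cf n \<epsilon>)) j) = \<eta> j"
    by (intro limI tendsto_eventually)
  then show "rev_bar L \<epsilon> j = \<eta> j" using not_ge unfolding rev_bar_def by simp
qed

lemma rev_cf_supp_nz:
  assumes "0 < \<epsilon> 1" "0 < n"
  shows "\<forall>j>n. rev_cf n \<epsilon> j = 0" "rev_cf n \<epsilon> \<noteq> (\<lambda>_. 0)"
proof -
  have "rev_cf n \<epsilon> n = \<epsilon> 1" using assms by (simp add: rev_cf_def)
  then show "rev_cf n \<epsilon> \<noteq> (\<lambda>_. 0)" using assms(1) by auto
qed (simp add: rev_cf_def)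

lemma rev_bar_admissible:
  assumes L: "zeck_list L" and e: "\<epsilon> 0 = 0" "0 < \<epsilon> 1"
    and not_ge: "\<not> (\<epsilon> = beta_bar L 1 \<or> less_d (beta_bar L 1) \<epsilon>)"
    and adm: "admissible (dig L) (\<lambda>i. \<epsilon> (Suc i))"
  shows "rev_bar L \<epsilon> = \<epsilon>"
proof (rule rev_bar_eqI[where k = 0, OF not_ge])
  fix n :: nat assume "0 < n"
  then show "bar_cf L (rev_cf n \<epsilon>) = rev_cf n \<epsilon>"
    using rev_cf_supp_nz[of \<epsilon>, OF e(2)] rev_cf_in_int_collection_iff[OF L] admissible_trunc[OF adm]
    by (intro bar_cf_eq[OF L]) auto
qed (rule e(1))

text \<open>At the first digit that is too large, the least admissible expansion above is obtained by
  cutting just before the current block and increasing the preceding digit.\<close>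

lemma rev_bar_inadmissible:
  assumes L: "zeck_list L" and e: "\<epsilon> 0 = 0" "0 < \<epsilon> 1"
    and not_ge: "\<not> (\<epsilon> = beta_bar L 1 \<or> less_d (beta_bar L 1) \<epsilon>)"
    and nadm: "\<not> admissible (dig L) (\<lambda>i. \<epsilon> (Suc i))"
  obtains y p where "rev_bar L \<epsilon> = case_nat 0 y" "admissible (dig L) y" "\<And>i. p < i \<Longrightarrow> y i = 0"
    "0 < y 0" "\<epsilon> (Suc p) < y p" "\<And>i. i < p \<Longrightarrow> \<epsilon> (Suc i) = y i"
proof -
  let ?b = "dig L"
  define x where "x = (\<lambda>i. \<epsilon> (Suc i))"
  have "\<exists>k. \<not> x k \<le> ?b (pstate ?b x k)"
    using nadm unfolding admissible_def x_def[symmetric] by blast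
  then obtain k where "\<not> x k \<le> ?b (pstate ?b x k)" "\<forall>j<k. \<not> \<not> x j \<le> ?b (pstate ?b x j)"
    using exists_least_iff[of "\<lambda>k. \<not> x k \<le> ?b (pstate ?b x k)"] by blast
  then have k: "?b (pstate ?b x k) < x k" "\<And>j. j < k \<Longrightarrow> x j \<le> ?b (pstate ?b x j)" by auto
  define s where "s = pstate ?b x k"
  have run: "x (k - s + j) = ?b j" "pstate ?b x (k - s + j) = j" if "j < s" for j
    using pstate_run_match[of j ?b x k] pstate_run[of j ?b x k] that by (auto simp: s_def)
  \<comment> \<open>Otherwise the expansion follows \<open>beta_bar L 1\<close> before position
    \<open>k\<close> and exceeds it there, against \<open>not_ge\<close>. So some digit precedes the
    current block.\<close>
  have "s \<noteq> k"
  proof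
    assume "s = k"
    then have "beta_bar L 1 (Suc k) < \<epsilon> (Suc k)" using k(1) by (simp add: beta_bar_dig x_def s_def)
    moreover have "beta_bar L 1 j = \<epsilon> j" if "j < Suc k" for j
      using run(1)[of "j - 1"] that e(1) \<open>s = k\<close> by (cases j) (simp_all add: beta_bar_dig x_def)
    ultimately show False using not_ge unfolding less_d_def by blast
  qed
  then have sk: "s < k" using pstate_le[of ?b x k] by (simp add: s_def)
  define p where "p = k - s - 1"
  have p: "p < k" "Suc p = k - s" using sk by (auto simp: p_def)
  have "pstate ?b x (Suc p) = 0" using pstate_run[of 0 ?b x k] p by (simp add: s_def)
  \<comment> \<open>The state after \<open>p\<close> is 0, so the digit at \<open>p\<close> is a
    mismatch below its bound and can be raised by one.\<close>
  then have xp: "x p < ?b (pstate ?b x p)" using k(2)[OF p(1)] by (auto split: if_splits)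
  define y where "y i = (if i < p then x i else if i = p then Suc (x p) else 0)" for i
  have st_y: "pstate ?b y i = pstate ?b x i" if "i \<le> p" for i
    using that by (intro pstate_cong) (auto simp: y_def)
  have y_adm: "admissible ?b y"
    unfolding admissible_def
  proof
    fix i show "y i \<le> ?b (pstate ?b y i)"
      using k(2)[of i] xp p st_y[of i] by (auto simp: y_def)
  qed
  have "rev_bar L \<epsilon> = case_nat 0 y"
  proof (rule rev_bar_eqI[OF not_ge])
    fix n assume n: "k < n"
    show "bar_cf L (rev_cf n \<epsilon>) = rev_cf n (case_nat 0 y)"
    proof (rule bar_cf_eq[OF L])
      show "\<forall>j>n. rev_cf n \<epsilon> j = 0" "rev_cf n \<epsilon> \<noteq> (\<lambda>_. 0)"
        using rev_cf_supp_nz[of \<epsilon>, OF e(2), of n] n by auto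
      show "rev_cf n (case_nat 0 y) \<in> int_collection L"
        using rev_cf_in_int_collection_iff[OF L] admissible_trunc[OF y_adm] by simp
      have "rev_cf n \<epsilon> (n - i) = x i" if "i < n" for i
        using that by (simp add: rev_cf_def x_def)
      then have "less_a (rev_cf n \<epsilon>) (rev_cf n (case_nat 0 y))"
        unfolding less_a_rev_cf_iff using n p(1)
        by (intro conjI exI[of _ p]) (simp_all add: y_def rev_cf_def)
      then show "rev_cf n (case_nat 0 y) = rev_cf n \<epsilon> \<or> less_a (rev_cf n \<epsilon>) (rev_cf n (case_nat 0 y))" by blast
      \<comment> \<open>Such a member differs from \<open>x\<close> at or before \<open>k\<close>,
        where \<open>x\<close> breaks admissibility. If the first difference is at or before
        \<open>p\<close>, it is downward because the member lies below \<open>y\<close>; if it is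
        later, because there \<open>x\<close> matches the stream until it exceeds it at
        \<open>k\<close>.\<close>
      show "less_a \<xi> (rev_cf n \<epsilon>)" if \<xi>: "\<xi> \<in> int_collection L" "less_a \<xi> (rev_cf n (case_nat 0 y))" for \<xi>
      proof -
        obtain i0 where supp: "\<forall>j>n. \<xi> j = 0" and i0: "i0 < n" "\<xi> (n - i0) < y i0"
            "\<And>j. j < i0 \<Longrightarrow> \<xi> (n - j) = y j"
          using \<xi>(2) unfolding less_a_rev_cf_iff by auto
        define z where "z = (\<lambda>i. rev_cf n \<xi> (Suc i))"
        have z: "z i = \<xi> (n - i)" if "i < n" for i using that by (simp add: z_def rev_cf_def)
        have adm_z: "admissible ?b z"
          using int_collection_iff[OF L supp] \<xi>(1) by (simp add: z_def)
        have zi0: "z i0 < y i0" "\<And>j. j < i0 \<Longrightarrow> z j = y j" using i0 z by simp_all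
        have i0p: "i0 \<le> p" using zi0(1) by (rule contrapos_pp) (simp add: y_def)
        have "\<exists>i\<le>k. z i \<noteq> x i"
        proof (rule ccontr)
          assume "\<not> (\<exists>i\<le>k. z i \<noteq> x i)"
          then have "pstate ?b z k = pstate ?b x k" "z k = x k" by (auto intro!: pstate_cong)
          then show False using adm_z k(1) unfolding admissible_def by (metis not_le)
        qed
        then obtain i where i: "i \<le> k" "z i \<noteq> x i" "\<And>j. j < i \<Longrightarrow> z j = x j"
          using exists_least_iff[of "\<lambda>i. i \<le> k \<and> z i \<noteq> x i"] by auto
        have "z i < x i"
        proof (cases "i \<le> p")
          case True
          have "i0 = i"
          proof (cases i0 i rule: linorder_cases)
            case less
            then show ?thesis using i(3)[OF less] zi0(1) True by (simp add: y_def)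
          next
            case greater
            then show ?thesis using zi0(2)[OF greater] i(2) i0p by (simp add: y_def)
          qed
          then show ?thesis using zi0(1) i(2) True by (auto simp: y_def split: if_splits)
        next
          case False
          have "z i \<le> ?b (pstate ?b x i)"
            using adm_z pstate_cong[of i z x ?b] i(3) unfolding admissible_def by metis
          also have "\<dots> \<le> x i"
          proof (cases "i = k")
            case True
            then show ?thesis using k(1) by simp
          next
            case ik: False
            then have "i - (k - s) < s" "k - s + (i - (k - s)) = i" using i(1) False p sk by auto
            then show ?thesis using run[of "i - (k - s)"] by simp
          qed
          finally show ?thesis using i(2) by simp
        qed
        then show ?thesis
          unfolding less_a_rev_cf_iff using supp i n z by (auto simp: x_def intro!: exI[of _ i])
      qed
    qed
  qed simp
  moreover have "0 < y 0" using e(2) by (auto simp: y_def x_def)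
  ultimately show ?thesis using that[of y p] y_adm by (simp add: y_def x_def)
qed

section \<open>Minimising the quotient\<close>

text \<open>Concavity of ln at the points 1 + u and 1 with weights g and 1 - g, whose mean is
  \<open>v\<close>. After division by \<open>v\<close> the tangent bound ln t \<le> t - 1
  suffices.\<close>

lemma powr_le_one_plus:
  fixes u g :: real
  assumes "0 \<le> u" "0 \<le> g" "g \<le> 1"
  shows "(1 + u) powr g \<le> 1 + g * u"
proof -
  define v where "v = 1 + g * u"
  have v: "0 < v" using assms by (simp add: v_def add_pos_nonneg)
  have "g * ln ((1 + u) / v) + (1 - g) * ln (1 / v) \<le> g * ((1 + u) / v - 1) + (1 - g) * (1 / v - 1)"
    using assms v by (intro add_mono mult_left_mono ln_le_minus_one) auto
  also have "\<dots> = (g * (1 + u) + (1 - g)) / v - 1" using v by (simp add: field_simps)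
  also have "g * (1 + u) + (1 - g) = v" by (simp add: v_def algebra_simps)
  finally have "g * ln ((1 + u) / v) + (1 - g) * ln (1 / v) \<le> 0" using v by simp
  moreover have "g * ln ((1 + u) / v) + (1 - g) * ln (1 / v) = g * ln (1 + u) - ln v"
    using assms v by (simp add: ln_div algebra_simps)
  ultimately have "g * ln (1 + u) \<le> ln v" by simp
  then have "exp (g * ln (1 + u)) \<le> v" using v by (simp add: ln_ge_iff)
  moreover have "(1 + u) powr g = exp (g * ln (1 + u))" using assms(1) by (simp add: powr_def)
  ultimately show ?thesis by (simp add: v_def)
qed

lemma pstate_self: "pstate b b i = i"
  by (induction i) auto

lemma val_mono_base:
  assumes "0 < v" "v \<le> w" "w < 1" "\<And>k. x k \<le> C"
  shows "val v x \<le> val w x"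
  unfolding val_def using assms
  by (intro suminf_le summable_val[of _ _ C] mult_left_mono power_mono) auto

text \<open>Passing from base \<open>w\<close> to \<open>v\<close> multiplies the k-th term by
  (v/w)^(k+1), which is at most v/w.\<close>

lemma val_ratio:
  assumes "0 < v" "v \<le> w" "w < 1" "\<And>k. x k \<le> C"
  shows "w * val v x \<le> v * val w x"
proof -
  have sv: "summable (\<lambda>k. real (x k) * v ^ Suc k)" and sw: "summable (\<lambda>k. real (x k) * w ^ Suc k)"
    using assms summable_val[of v x C] summable_val[of w x C] by simp_all
  have "w * (real (x k) * v ^ Suc k) \<le> v * (real (x k) * w ^ Suc k)" for k
  proof -
    have "(w * v * real (x k)) * v ^ k \<le> (w * v * real (x k)) * w ^ k"
      using assms by (intro mult_left_mono power_mono) auto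
    then show ?thesis by (simp add: mult_ac)
  qed
  then show ?thesis
    unfolding val_def suminf_mult[OF sv, symmetric] suminf_mult[OF sw, symmetric]
    by (intro suminf_le summable_mult sv sw)
qed

section \<open>Two nested collections and their bases\<close>

locale two_expansions =
  fixes L L' :: "nat list"
  assumes L: "zeck_list L" and L': "zeck_list L'" and sub: "int_collection L \<subset> int_collection L'"
begin

abbreviation "w \<equiv> omega L"
abbreviation "v \<equiv> omega L'"
abbreviation "g \<equiv> gam L L'"
abbreviation "C \<equiv> Max (set L)"

sublocale E: expansion "dig L" w C
  by (rule expansion_dig[OF L])

sublocale E': expansion "dig L'" v "Max (set L')"
  by (rule expansion_dig[OF L'])

text \<open>The inclusion concerns finite sums; it extends to infinite sequences because
  admissibility can be tested on truncations.\<close>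

lemma admissible_transfer:
  assumes "admissible (dig L) x"
  shows "admissible (dig L') x"
proof (rule admissible_if_trunc)
  fix m
  have "rev_cf m (case_nat 0 x) \<in> int_collection L"
    using rev_cf_in_int_collection_iff[OF L, of m "case_nat 0 x"] admissible_trunc[OF assms] by simp
  then have "rev_cf m (case_nat 0 x) \<in> int_collection L'" using sub by blast
  then show "admissible (dig L') (trunc m x)"
    using rev_cf_in_int_collection_iff[OF L', of m "case_nat 0 x"] by simp
qed

lemma dig_neq: "dig L \<noteq> dig L'"
proof
  assume eq: "dig L = dig L'"
  have "\<mu> \<in> int_collection L" if \<mu>: "\<mu> \<in> int_collection L'" for \<mu>
  proof -
    obtain M where M: "\<forall>j>M. \<mu> j = 0" using int_collection_imp_ex(2)[OF L' \<mu>] by blast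
    then show ?thesis using int_collection_iff[OF L M] int_collection_iff[OF L' M] \<mu> eq by simp
  qed
  then show False using sub by blast
qed

text \<open>The stream of \<open>L\<close> is admissible for \<open>L'\<close>. If
  \<open>v \<ge> w\<close>, its value in base \<open>v\<close> would be at least 1, which an
  \<open>L'\<close>-admissible sequence reaches only without any mismatch, that is, as the stream of
  \<open>L'\<close>. Strict inclusion forbids this.\<close>

lemma v_less_w: "v < w"
proof (rule ccontr)
  assume "\<not> v < w"
  then have "val w (dig L) \<le> val v (dig L)"
    using val_mono_base[of w v "dig L" C] E.w E'.w E.b_le by simp
  then have ge: "1 \<le> val v (dig L)" by (simp add: E.val_b)
  have "admissible (dig L) (dig L)" by (simp add: admissible_def pstate_self)
  then have adm: "admissible (dig L') (dig L)" by (rule admissible_transfer)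
  have "dig L i = dig L' (pstate (dig L') (dig L) i)" for i
    using E'.val_less_1[OF adm, of i] ge by linarith
  moreover from this have "pstate (dig L') (dig L) i = i" for i
    by (induction i) auto
  ultimately show False using dig_neq by auto
qed

lemma gam_bounds: "0 < g" "g < 1" and powr_gam: "v powr g = w"
proof -
  have ln: "ln v < ln w" "ln w < 0" using v_less_w E.w E'.w by simp_all
  have geq: "g = ln w / ln v"
    using E.w E'.w by (simp add: gam_def log_def omega_def ln_div)
  then show "0 < g" "g < 1" using ln by (simp_all add: zero_less_divide_iff divide_less_eq)
  show "v powr g = w" unfolding geq powr_def using ln E'.w E.w by simp
qed

text \<open>The quotient with \<open>rev_bar\<close> removed, as it is the identity on
  \<open>L\<close>-admissible expansions with positive leading digit.\<close>

definition ratio :: "(nat \<Rightarrow> nat) \<Rightarrow> real" where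
  "ratio x = val w x / val v x powr g"

lemma val_v_ge:
  assumes "\<And>k. x k \<le> K" "0 < x 0"
  shows "v \<le> val v x"
proof -
  have "v * 1 \<le> v * (real (x 0) + val v (\<lambda>k. x (Suc k)))"
    using val_nonneg[OF E'.w, of "\<lambda>k. x (Suc k)" K] assms E'.w by (intro mult_left_mono) auto
  then show ?thesis using val_Suc[OF E'.w, of x K] assms by simp
qed

text \<open>The dropped digits add w^m A to the numerator, while by Bernoulli's inequality they
  enlarge the denominator at most by the factor 1 + g v^m B / Y0. It remains to see that the gain
  covers X0 times the excess of that factor over 1.\<close>

lemma ratio_trunc_le:
  assumes adm: "admissible (dig L) x" and x0: "0 < x 0"
    and m: "0 < m" "g * v ^ m \<le> w ^ Suc m"
  shows "ratio (trunc m x) \<le> ratio x"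
proof -
  note xC = E.x_le[OF adm]
  define X0 where "X0 = val w (trunc m x)"
  define Y0 where "Y0 = val v (trunc m x)"
  define A where "A = val w (\<lambda>k. x (m + k))"
  define B where "B = val v (\<lambda>k. x (m + k))"
  have tC: "trunc m x k \<le> C" for k using xC by (simp add: trunc_def)
  have tm: "trunc m x (m + k) = 0" for k by (simp add: trunc_def)
  have split: "val u x = val u (trunc m x) + u ^ m * val u (\<lambda>k. x (m + k))" if "0 < u" "u < 1" for u
  proof -
    have "val u (trunc m x) = (\<Sum>k<m. real (trunc m x k) * u ^ Suc k)"
      using val_split[OF that, of "trunc m x" C m] tC by (simp add: tm val_def)
    then show ?thesis
      using val_split[OF that, of x C m] xC by (simp add: trunc_def)
  qed
  have nn: "0 \<le> A" "0 \<le> B" "0 \<le> X0"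
    using val_nonneg[OF E.w, of "\<lambda>k. x (m + k)" C] val_nonneg[OF E'.w, of "\<lambda>k. x (m + k)" C]
      val_nonneg[OF E.w, of "trunc m x" C] xC tC by (simp_all add: A_def B_def X0_def)
  have X1: "X0 \<le> 1" using E.val_le_1[OF admissible_trunc[OF adm]] by (simp add: X0_def)
  \<comment> \<open>Since \<open>0 < m\<close>, the leading digit is kept.\<close>
  have Yv: "v \<le> Y0" unfolding Y0_def using x0 m(1) tC by (intro val_v_ge[of _ C]) (simp_all add: trunc_def)
  then have Y0: "0 < Y0" using E'.w by linarith
  have AB: "w * B \<le> v * A"
    unfolding A_def B_def using val_ratio[of v w "\<lambda>k. x (m + k)" C] E.w E'.w v_less_w xC by simp
  have vm: "0 < v ^ m" using E'.w by simp
  have "(g * v ^ m) * B \<le> w ^ Suc m * B" using m(2) nn by (intro mult_right_mono)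
  also have "\<dots> = w ^ m * (w * B)" by simp
  also have "\<dots> \<le> w ^ m * (v * A)" using AB E.w by (intro mult_left_mono) auto
  \<comment> \<open>The hypothesis \<open>m(2)\<close> supplies one power of \<open>w\<close> beyond
    the m-th, and \<open>AB\<close> spends it on passing from B to A.\<close>
  finally have key: "g * (v ^ m * B) \<le> v * (w ^ m * A)" by (simp add: mult_ac)
  \<comment> \<open>The bounds \<open>X0 \<le> 1\<close> and \<open>v \<le> Y0\<close> do not depend
    on the expansion, which makes one p serve for all.\<close>
  have 1: "X0 * (1 + g * (v ^ m * B / Y0)) \<le> X0 + w ^ m * A"
  proof -
    have "X0 * (g * (v ^ m * B)) \<le> 1 * (g * (v ^ m * B))"
      using X1 nn gam_bounds E'.w by (intro mult_right_mono) auto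
    also have "\<dots> \<le> v * (w ^ m * A)" using key by simp
    also have "\<dots> \<le> Y0 * (w ^ m * A)" using Yv nn E.w by (intro mult_right_mono) auto
    finally show ?thesis using Y0 by (simp add: field_simps)
  qed
  have 2: "(Y0 + v ^ m * B) powr g \<le> Y0 powr g * (1 + g * (v ^ m * B / Y0))"
  proof -
    have "Y0 + v ^ m * B = Y0 * (1 + v ^ m * B / Y0)" using Y0 by (simp add: field_simps)
    then have "(Y0 + v ^ m * B) powr g = Y0 powr g * (1 + v ^ m * B / Y0) powr g"
      using Y0 nn vm by (simp add: powr_mult)
    also have "\<dots> \<le> Y0 powr g * (1 + g * (v ^ m * B / Y0))"
      using Y0 nn vm gam_bounds by (intro mult_left_mono powr_le_one_plus) auto
    finally show ?thesis .
  qed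
  have "X0 * (Y0 + v ^ m * B) powr g \<le> X0 * (Y0 powr g * (1 + g * (v ^ m * B / Y0)))"
    using 2 nn by (intro mult_left_mono)
  also have "\<dots> = (X0 * (1 + g * (v ^ m * B / Y0))) * Y0 powr g" by simp
  also have "\<dots> \<le> (X0 + w ^ m * A) * Y0 powr g" using 1 by (intro mult_right_mono) auto
  finally have "X0 * (Y0 + v ^ m * B) powr g \<le> (X0 + w ^ m * A) * Y0 powr g" .
  moreover have "0 < Y0 powr g" "0 < (Y0 + v ^ m * B) powr g"
    using Y0 add_pos_nonneg[of Y0 "v ^ m * B"] nn vm by simp_all
  ultimately have "X0 / Y0 powr g \<le> (X0 + w ^ m * A) / (Y0 + v ^ m * B) powr g"
    by (simp add: divide_simps mult_ac)
  then show ?thesis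
    unfolding ratio_def split[OF E.w] split[OF E'.w] X0_def Y0_def A_def B_def .
qed

section \<open>Evaluating and bounding delta_star\<close>

lemma delta_star_eq_delta_one:
  assumes "v \<le> y" "y < 1"
  shows "delta_star L L' y = delta_one L L' y"
proof -
  have "(THE n. 1 \<le> n \<and> v ^ n \<le> y \<and> y < v ^ (n - 1)) = 1"
  proof (rule the_equality)
    show "1 \<le> (1::nat) \<and> v ^ 1 \<le> y \<and> y < v ^ (1 - 1)" using assms by simp
    show "n = 1" if n: "1 \<le> n \<and> v ^ n \<le> y \<and> y < v ^ (n - 1)" for n
    proof (rule ccontr)
      assume "n \<noteq> 1"
      then have "v ^ (n - 1) \<le> v ^ 1" using n E'.w by (intro power_decreasing) auto
      then show False using n assms by simp
    qed
  qed
  then show ?thesis unfolding delta_star_def by simp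
qed

text \<open>By definition \<open>delta_star\<close> is invariant under scaling by \<open>v\<close>,
  so lower bounds are needed only on \<open>[v, 1)\<close>. The exponent in its definition is the
  least n with \<open>v ^ n \<le> y\<close>.\<close>

lemma delta_star_scale:
  assumes "0 < y" "y < 1"
  obtains z where "v \<le> z" "z < 1" "delta_star L L' y = delta_one L L' z"
proof -
  have "\<exists>n. v ^ n \<le> y" using real_arch_pow_inv[OF assms(1) E'.w(2)] less_imp_le by blast
  then obtain n where n: "v ^ n \<le> y" "\<forall>m<n. \<not> v ^ m \<le> y"
    using exists_least_iff[of "\<lambda>n. v ^ n \<le> y"] by blast
  have n1: "1 \<le> n" using n(1) assms by (cases n) auto
  have lt: "y < v ^ (n - 1)" using n(2) n1 by (simp add: not_le)
  have "(THE n. 1 \<le> n \<and> v ^ n \<le> y \<and> y < v ^ (n - 1)) = n"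
  proof (rule the_equality)
    show "1 \<le> n \<and> v ^ n \<le> y \<and> y < v ^ (n - 1)" using n n1 lt by simp
    show "k = n" if k: "1 \<le> k \<and> v ^ k \<le> y \<and> y < v ^ (k - 1)" for k
    proof (rule ccontr)
      assume "k \<noteq> n"
      then have "n < k" using n(2) k by (meson linorder_neqE_nat)
      then have "v ^ (k - 1) \<le> v ^ n" using E'.w by (intro power_decreasing) auto
      then show False using n k by simp
    qed
  qed
  then have "delta_star L L' y = delta_one L L' (y / v ^ (n - 1))" unfolding delta_star_def by simp
  moreover have "v ^ n = v * v ^ (n - 1)" using n1 by (simp flip: power_Suc)
  then have "v \<le> y / v ^ (n - 1)" "y / v ^ (n - 1) < 1"
    using n(1) lt E'.w by (simp_all add: le_divide_eq)
  ultimately show ?thesis using that by blast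
qed

lemma delta_one_eq:
  assumes "\<epsilon> \<in> star_collection L'"
  shows "delta_one L L' (wsum \<epsilon> (Qseq L')) = wsum (rev_bar L \<epsilon>) (Qseq L) / wsum \<epsilon> (Qseq L') powr g"
proof -
  have "(THE \<epsilon>'. \<epsilon>' \<in> star_collection L' \<and> wsum \<epsilon>' (Qseq L') = wsum \<epsilon> (Qseq L')) = \<epsilon>"
  proof (rule the_equality)
    fix \<epsilon>' assume \<epsilon>': "\<epsilon>' \<in> star_collection L' \<and> wsum \<epsilon>' (Qseq L') = wsum \<epsilon> (Qseq L')"
    note 1 = star_collection_imp[OF L' assms] and 2 = star_collection_imp[OF L', of \<epsilon>']
    have "(\<lambda>i. \<epsilon>' (Suc i)) = (\<lambda>i. \<epsilon> (Suc i))"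
      using 1 2 \<epsilon>' by (intro E'.val_inj) (simp_all add: wsum_Qseq)
    then have "\<epsilon>' k = \<epsilon> k" for k
      using 1(1) 2(1) \<epsilon>' by (cases k) (auto dest: fun_cong)
    then show "\<epsilon>' = \<epsilon>" by blast
  qed (use assms in simp)
  then show ?thesis by (simp add: delta_one_def)
qed

text \<open>Finite support makes \<open>x\<close> recurrent for both streams at once and keeps it
  strictly below \<open>beta_bar L 1\<close>, so that \<open>rev_bar\<close> leaves it
  unchanged.\<close>

lemma finite_expansion:
  assumes adm: "admissible (dig L) x" and x0: "0 < x 0" and supp: "\<And>i. m \<le> i \<Longrightarrow> x i = 0"
  shows "case_nat 0 x \<in> star_collection L" "v \<le> wsum (case_nat 0 x) (Qseq L')"
    "wsum (case_nat 0 x) (Qseq L') < 1" "delta_star_at L L' (case_nat 0 x) = ratio x"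
proof -
  let ?\<epsilon> = "case_nat 0 x"
  have nz: "?\<epsilon> \<noteq> (\<lambda>_. 0)" using x0 by (auto dest!: fun_cong[of _ _ 1])
  have adm': "admissible (dig L') x" by (rule admissible_transfer[OF adm])
  have rec: "recurrent (dig L) x" "recurrent (dig L') x"
    using E.finite_support_recurrent E'.finite_support_recurrent supp by blast+
  show "?\<epsilon> \<in> star_collection L" using nz adm rec by (intro star_collectionI) auto
  have star': "?\<epsilon> \<in> star_collection L'" using nz adm' rec by (intro star_collectionI) auto
  show ge: "v \<le> wsum ?\<epsilon> (Qseq L')" using val_v_ge[of x C] E.x_le[OF adm] x0 by (simp add: wsum_Qseq)
  obtain i where "x i \<noteq> dig L' (pstate (dig L') x i)" using rec(2) unfolding recurrent_def by blast
  then show less: "wsum ?\<epsilon> (Qseq L') < 1" using E'.val_less_1[OF adm'] by (simp add: wsum_Qseq)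
  have "?\<epsilon> \<noteq> beta_bar L 1"
  proof
    assume eq: "?\<epsilon> = beta_bar L 1"
    obtain t where t: "t \<ge> m" "0 < dig L t" using E.b_inf by blast
    have "x t = dig L t" using fun_cong[OF eq, of "Suc t"] by (simp add: beta_bar_dig)
    then show False using supp[OF t(1)] t(2) by simp
  qed
  moreover have "\<not> less_d (beta_bar L 1) ?\<epsilon>"
  proof
    assume "less_d (beta_bar L 1) ?\<epsilon>"
    then obtain k where k: "beta_bar L 1 k < ?\<epsilon> k" "\<And>j. j < k \<Longrightarrow> beta_bar L 1 j = ?\<epsilon> j"
      unfolding less_d_def by blast
    then obtain i where i: "k = Suc i" by (cases k) auto
    have "x j = dig L j" if "j < i" for j using k(2)[of "Suc j"] i that by (simp add: beta_bar_dig)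
    then have "pstate (dig L) x i = i" using pstate_cong[of i x "dig L" "dig L"] by (simp add: pstate_self)
    then show False using adm k(1) i by (auto simp: admissible_def beta_bar_dig dest: spec[of _ i])
  qed
  ultimately have "rev_bar L ?\<epsilon> = ?\<epsilon>" using x0 adm by (intro rev_bar_admissible[OF L]) auto
  then show "delta_star_at L L' ?\<epsilon> = ratio x"
    unfolding delta_star_at_def delta_star_eq_delta_one[OF ge less] delta_one_eq[OF star']
    by (simp add: wsum_Qseq ratio_def)
qed

abbreviation one_digit :: "nat \<Rightarrow> nat \<Rightarrow> nat" where
  "one_digit c \<equiv> (\<lambda>i. if i = 0 then c else 0)"

lemma val_one_digit: "val u (one_digit c) = real c * u"
proof -
  have "(\<lambda>k. real (one_digit c k) * u ^ Suc k) = (\<lambda>k. if k = 0 then real c * u else 0)" by auto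
  then show ?thesis unfolding val_def using suminf_finite[of "{0}" "\<lambda>k. if k = 0 then real c * u else 0"]
    by simp
qed

text \<open>Since \<open>v powr g = w\<close>, the bases cancel; c = 1 gives the value 1 at
  \<open>unit_cf 1\<close>.\<close>

lemma ratio_one_digit:
  assumes "0 < c"
  shows "ratio (one_digit c) = real c powr (1 - g)"
proof -
  have "ratio (one_digit c) = real c * w / (real c powr g * w)"
    using assms E'.w by (simp add: ratio_def val_one_digit powr_mult powr_gam)
  also have "\<dots> = real c powr 1 / real c powr g" using E.w assms by simp
  finally show ?thesis by (simp add: powr_diff)
qed

lemma admissible_one_digit: "admissible (dig L) (one_digit 1)"
  using E.b0 by (auto simp: admissible_def Suc_le_eq)

lemma delta_one_ge_ratio:
  assumes z: "v \<le> z" "z < 1"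
  obtains x where "admissible (dig L) x" "0 < x 0" "ratio x \<le> delta_one L L' z"
proof -
  have z0: "0 < z" using z E'.w by linarith
  obtain x where x: "admissible (dig L') x" "recurrent (dig L') x" "val v x = z"
    using E'.val_surj[of z] z z0 by auto
  \<comment> \<open>With leading digit 0 the value would be \<open>v\<close> times a tail in state
    0, hence below \<open>v\<close>.\<close>
  have x0: "0 < x 0"
  proof (rule ccontr)
    assume "\<not> 0 < x 0"
    then have "x 0 = 0" "pstate (dig L') x (Suc 0) = 0" using E'.b0 by auto
    obtain j where "1 \<le> j" "x j \<noteq> dig L' (pstate (dig L') x j)"
      using x(2) unfolding recurrent_def by blast
    then have "val v (\<lambda>j. x (Suc 0 + j)) < 1"
      using E'.val_tail_less[OF x(1), of "Suc 0" j] \<open>pstate (dig L') x (Suc 0) = 0\<close> E'.mtail_0 by simp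
    then have "v * val v (\<lambda>j. x (Suc 0 + j)) < v * 1" using E'.w by (intro mult_strict_left_mono)
    then show False using E'.val_tail_Suc[OF x(1), of 0] \<open>x 0 = 0\<close> x(3) z by simp
  qed
  let ?\<epsilon> = "case_nat 0 x"
  have "?\<epsilon> \<noteq> (\<lambda>_. 0)" using x0 by (auto dest!: fun_cong[of _ _ 1])
  then have "?\<epsilon> \<in> star_collection L'" using x by (intro star_collectionI) auto
  then have d: "delta_one L L' z = wsum (rev_bar L ?\<epsilon>) (Qseq L) / z powr g"
    using delta_one_eq[of ?\<epsilon>] x(3) by (simp add: wsum_Qseq)
  show ?thesis
  proof (cases "?\<epsilon> = beta_bar L 1 \<or> less_d (beta_bar L 1) ?\<epsilon>")
    \<comment> \<open>From \<open>beta_bar L 1\<close> upwards the numerator is 1 and the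
      denominator at most 1, so the single digit 1, of ratio 1, does as well.\<close>
    case True
    then have "wsum (rev_bar L ?\<epsilon>) (Qseq L) = 1"
      using E.val_b by (simp add: rev_bar_def wsum_Qseq beta_bar_dig)
    moreover have "z powr g \<le> 1" using z z0 gam_bounds powr_mono2[of g z 1] by simp
    ultimately have "1 \<le> delta_one L L' z" using d z0 by (simp add: le_divide_eq)
    then show ?thesis
      using that[of "one_digit 1"] admissible_one_digit ratio_one_digit[of 1] by simp
  next
    case not_ge: False
    show ?thesis
    proof (cases "admissible (dig L) x")
      case True
      then have "rev_bar L ?\<epsilon> = ?\<epsilon>" using not_ge x0 by (intro rev_bar_admissible[OF L]) auto
      then have "delta_one L L' z = ratio x" using d x(3) by (simp add: wsum_Qseq ratio_def)
      then show ?thesis using that[of x] True x0 by simp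
    next
      case False
      obtain y p where y: "rev_bar L ?\<epsilon> = case_nat 0 y" "admissible (dig L) y" "\<And>i. p < i \<Longrightarrow> y i = 0"
        "0 < y 0" "?\<epsilon> (Suc p) < y p" "\<And>i. i < p \<Longrightarrow> ?\<epsilon> (Suc i) = y i"
        using rev_bar_inadmissible[OF L _ _ not_ge] False x0 by auto
      have "val v x < val v y"
        using y(5,6) by (intro E'.val_strict_mono[OF x(1,2) admissible_transfer[OF y(2)], of p]) auto
      then have "z powr g \<le> val v y powr g" using x(3) z0 gam_bounds by (intro powr_mono2) auto
      moreover have "0 \<le> val w y" using val_nonneg[OF E.w] E.x_le[OF y(2)] by blast
      moreover have "0 < z powr g" using z0 by simp
      ultimately have "ratio y \<le> delta_one L L' z"
        unfolding d y(1) ratio_def by (simp add: wsum_Qseq frac_le)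
      then show ?thesis using that[of y] y by simp
    qed
  qed
qed

text \<open>The condition on p reads g/v < (w/v)^p, which is solvable because 1 < w/v. When p = 1 it
  has to be carried over to exponent 2; multiplying by \<open>v < w\<close> does this.\<close>

lemma pmin_bound: "g * v ^ (max 2 (pmin L L') - 1) \<le> w ^ max 2 (pmin L L')"
proof -
  have r: "1 < w / v" using v_less_w E'.w by simp
  obtain n where n: "g / v < (w / v) ^ n" using real_arch_pow[OF r] by blast
  have "g / v < (w / v) ^ Suc n"
    using n r less_le_trans[OF n power_increasing[of n "Suc n" "w / v"]] by simp
  then have "g * v ^ n < w ^ Suc n"
    using E'.w by (simp add: power_divide divide_simps mult_ac)
  then have "\<exists>p. 1 \<le> p \<and> g * v ^ (p - 1) < w ^ p" by (intro exI[of _ "Suc n"]) simp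
  then have p: "1 \<le> pmin L L'" "g * v ^ (pmin L L' - 1) < w ^ pmin L L'"
    unfolding pmin_def by (rule LeastI_ex[THEN conjunct1], rule LeastI_ex[THEN conjunct2])
  show ?thesis
  proof (cases "pmin L L' = 1")
    case True
    then have "g * v \<le> w * w" using p(2) v_less_w E'.w gam_bounds by (intro mult_mono) auto
    then show ?thesis using True by (simp add: power2_eq_square)
  next
    case False
    then show ?thesis using p by (simp add: max_def)
  qed
qed

text \<open>Any value of \<open>delta_star\<close> is bounded below by some ratio, and truncation
  moves that ratio, without increasing it, into a finite set that contains the single digit
  1.\<close>

lemma delta_star_minimum:
  assumes m: "m = max 2 (pmin L L') - 1"
  shows "\<exists>x. admissible (dig L) x \<and> 0 < x 0 \<and> (\<forall>i\<ge>m. x i = 0) \<and>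
    (\<forall>y. 0 < y \<and> y < 1 \<longrightarrow> ratio x \<le> delta_star L L' y)"
proof -
  let ?S = "{x. admissible (dig L) x \<and> 0 < x 0 \<and> (\<forall>i\<ge>m. x i = 0)}"
  have m1: "0 < m" "Suc m = max 2 (pmin L L')" unfolding m by auto
  have "?S \<subseteq> {x. \<forall>i. (i \<in> {..<m} \<longrightarrow> x i \<in> {..C}) \<and> (i \<notin> {..<m} \<longrightarrow> x i = 0)}"
    using E.x_le by auto
  then have "finite ?S" by (rule finite_subset) (rule finite_set_of_finite_funs, auto)
  moreover have "one_digit 1 \<in> ?S" using admissible_one_digit m1 by auto
  ultimately obtain x where x: "x \<in> ?S" "\<forall>y\<in>?S. ratio x \<le> ratio y"
    using ex_is_arg_min_if_finite[of ?S ratio] unfolding is_arg_min_linorder by blast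
  have "ratio x \<le> delta_star L L' y" if y: "0 < y" "y < 1" for y
  proof -
    obtain z where z: "v \<le> z" "z < 1" "delta_star L L' y = delta_one L L' z"
      using delta_star_scale[OF y] .
    obtain u where u: "admissible (dig L) u" "0 < u 0" "ratio u \<le> delta_one L L' z"
      using delta_one_ge_ratio[OF z(1,2)] .
    have "trunc m u \<in> ?S" using admissible_trunc[OF u(1)] u(2) m1 by (simp add: trunc_def)
    then have "ratio x \<le> ratio (trunc m u)" using x by blast
    also have "\<dots> \<le> ratio u"
      using pmin_bound unfolding m1(2)[symmetric] by (intro ratio_trunc_le u m1) simp
    finally show ?thesis using u z by simp
  qed
  then show ?thesis using x(1) by blast
qed

end

theorem theorem4p22:
  fixes L L' :: "nat list"
  assumes "zeck_list L" and "zeck_list L'"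
    and "int_collection L \<subset> int_collection L'"
  shows "(\<exists>\<epsilon>\<in>star_collection L.
            res_ge (max 2 (pmin L L')) \<epsilon> = (\<lambda>_. 0) \<and>
            wsum \<epsilon> (Qseq L') \<in> {0<..<1} \<and>
            (\<forall>y\<in>{0<..<1}. delta_star_at L L' \<epsilon> \<le> delta_star L L' y)) \<and>
         (pmin L L' \<le> 2 \<longrightarrow>
            wsum (unit_cf 1) (Qseq L') \<in> {0<..<1} \<and>
            delta_star_at L L' (unit_cf 1) = 1 \<and>
            (\<forall>y\<in>{0<..<1}. delta_star_at L L' (unit_cf 1) \<le> delta_star L L' y))"
proof -
  interpret two_expansions L L' using assms by unfold_locales
  define m where "m = max 2 (pmin L L') - 1"
  obtain x where x: "admissible (dig L) x" "0 < x 0" "\<And>i. m \<le> i \<Longrightarrow> x i = 0"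
    and min: "\<And>y. 0 < y \<Longrightarrow> y < 1 \<Longrightarrow> ratio x \<le> delta_star L L' y"
    using delta_star_minimum[OF m_def] by blast
  note fx = finite_expansion[of x m, OF x]
  \<comment> \<open>Position i is index i + 1, so vanishing from position \<open>m\<close> on means
    vanishing from index \<open>m + 1\<close>, the maximum of 2 and p.\<close>
  have "res_ge (max 2 (pmin L L')) (case_nat 0 x) = (\<lambda>_. 0)"
    using x(3) by (auto simp: res_ge_def m_def fun_eq_iff split: nat.split)
  moreover have "wsum (case_nat 0 x) (Qseq L') \<in> {0<..<1}" using fx(2,3) E'.w by simp
  ultimately have 1: "\<exists>\<epsilon>\<in>star_collection L.
            res_ge (max 2 (pmin L L')) \<epsilon> = (\<lambda>_. 0) \<and>
            wsum \<epsilon> (Qseq L') \<in> {0<..<1} \<and>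
            (\<forall>y\<in>{0<..<1}. delta_star_at L L' \<epsilon> \<le> delta_star L L' y)"
    using fx min by (intro bexI[of _ "case_nat 0 x"]) auto
  have unit: "unit_cf 1 = case_nat 0 (one_digit 1)"
    by (auto simp: unit_cf_def fun_eq_iff split: nat.split)
  have d1: "delta_star_at L L' (unit_cf 1) = 1"
    using finite_expansion(4)[OF admissible_one_digit, of 1] ratio_one_digit[of 1] unfolding unit by simp
  have "1 \<le> ratio x" if "pmin L L' \<le> 2"
  proof -
    \<comment> \<open>Only single digits c compete, and c powr (1 - g) is least for c = 1.\<close>
    have "m = 1" using that by (simp add: m_def)
    then have "x = one_digit (x 0)" using x(3) by auto
    then have "ratio x = real (x 0) powr (1 - g)" using ratio_one_digit[OF x(2)] by simp
    then show ?thesis using x(2) gam_bounds by (simp add: ge_one_powr_ge_zero)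
  qed
  moreover have "wsum (unit_cf 1) (Qseq L') \<in> {0<..<1}"
    using finite_expansion(2,3)[OF admissible_one_digit, of 1] E'.w unfolding unit by simp
  ultimately show ?thesis using 1 d1 min by force
qed

end
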